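(* Let $\mathcal{K}$ be a $\mu$-AEC (with $\mu$ a regular cardinal) and let $\chi = \mathrm{LS}(\mathcal{K})$. Then there exist a $\mu$-ary language $L_1 \supseteq L(\mathcal{K})$, an $(L_1)_{\mu,\mu}$-theory $T_1$ of size $\chi$, and a set $\Gamma$ of $\mu$-ary $(L_1)_{\mu,\mu}$-types with $|\Gamma| \le 2^{\chi}$ such that $\mathcal{K} = \mathrm{PC}^\mu(T_1, \Gamma, L(\mathcal{K}))$.
   Context: For an infinite cardinal $\mu$, a $\mu$-ary language $L$ consists of function and relation symbols, each with an arity that is an ordinal $<\mu$; an $L$-structure $M$ has a universe $|M|$, interprets an $n$-ary function symbol as a function ${}^{n}|M| \to |M|$ and an $n$-ary relation symbol as a subset of ${}^{n}|M|$. A $\mu$-abstract class is a pair $(\mathcal{K}, \le_{\mathcal{K}})$ where $\mathcal{K}$ is a class of $L$-structures for a fixed $\mu$-ary language $L = L(\mathcal{K})$, $\le_{\mathcal{K}}$ is a reflexive and transitive relation on $\mathcal{K}$ such that $M \le_{\mathcal{K}} N$ implies $M$ is an $L$-substructure of $N$, and which respects isomorphisms (if $f: N \cong N'$ and $N \in \mathcal{K}$ then $N' \in \mathcal{K}$, and if moreover $M \le_{\mathcal{K}} N$ then $f[M] \in \mathcal{K}$ and $f[M] \le_{\mathcal{K}} N'$). A poset $I$ is $\mu$-directed if every subset of size $<\mu$ has an upper bound. For $\mu$ regular, a $\mu$-abstract class is a $\mu$-AEC if: (Coherence) if $M_0, M_1, M_2 \in \mathcal{K}$, $M_0 \le_{\mathcal{K}}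 M_2$, $M_1 \le_{\mathcal{K}} M_2$ and $M_0 \subseteq M_1$, then $M_0 \le_{\mathcal{K}} M_1$; (Tarski–Vaught) if $\{M_i : i \in I\} \subseteq \mathcal{K}$ with $I$ $\mu$-directed and $i \le j \Rightarrow M_i \le_{\mathcal{K}} M_j$, then (a) $\bigcup_i M_i \in \mathcal{K}$ and $M_j \le_{\mathcal{K}} \bigcup_i M_i$ for all $j$, and (b) if $N \in \mathcal{K}$ with $M_i \le_{\mathcal{K}} N$ for all $i$, then $\bigcup_i M_i \le_{\mathcal{K}} N$; (Löwenheim–Skolem–Tarski) there is a cardinal $\lambda = \lambda^{<\mu} \ge |L(\mathcal{K})| + \mu$ such that for every $M \in \mathcal{K}$ and $A \subseteq |M|$ there is $N \le_{\mathcal{K}} M$ with $A \subseteq |N|$ and $|N| \le |A|^{<\mu} + \lambda$; $\mathrm{LS}(\mathcal{K})$ is the least such $\lambda$. For $\mu$-ary languages $L \subseteq L_1$, a $\mu$-ary $(L_1)_{\mu,\mu}$-type is a set of $(L_1)_{\mu,\mu}$-formulas all in the same free variables $\mathbf{x}$ with $\ell(\mathbf{x}) < \mu$; an $L_1$-structure omits it if no tuple satisfies all its formulas. For an $(L_1)_{\mu,\mu}$-theory $T_1$ and a set $\Gamma$ of such types, $\mathrm{EC}^\mu(T_1,\Gamma)$ is the class of $L_1$-structures that satisfy $T_1$ and omit every type in $\Gamma$, and $\mathrm{PC}^\mu(T_1,\Gamma,L) = \{M \upharpoonright L : M \in \mathrm{EC}^\mu(T_1,\Gamma)\}$. *)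

theory Defs
  imports Main "HOL-Library.FuncSet"
begin

unbundle cardinal_syntax

text \<open>
  A cardinal is a relation \<open>\<mu>\<close> with \<open>Card_order \<mu>\<close>. An ordinal below \<open>\<mu>\<close> is an element \<open>\<alpha>\<close> of
  \<open>Field \<mu>\<close>, and the set of its predecessors \<open>underS \<mu> \<alpha>\<close> plays the role of the von Neumann
  ordinal \<open>\<alpha>\<close>. Functions on an ordinal are extensional, so that equality of tuples, and hence of
  structures, terms and formulas, is the intended one.
\<close>

definition tuples :: "'m rel \<Rightarrow> 'm \<Rightarrow> 'a set \<Rightarrow> ('m \<Rightarrow> 'a) set" where
  "tuples \<mu> \<alpha> A = underS \<mu> \<alpha> \<rightarrow>\<^sub>E A"

text \<open>
  All tuples of length below \<open>\<mu>\<close>; the cardinality of this set is \<open>|A|\<^sup><\<^sup>\<mu>\<close>. The alternative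
  definition as a supremum of powers differs only if \<open>A\<close> has at most one element, which is
  irrelevant below because a cardinal that is at least \<open>\<mu>\<close> is always added.
\<close>

definition short_tuples :: "'m rel \<Rightarrow> 'a set \<Rightarrow> ('m \<times> ('m \<Rightarrow> 'a)) set" where
  "short_tuples \<mu> A = (SIGMA \<alpha>:Field \<mu>. tuples \<mu> \<alpha> A)"


section \<open>Languages and structures\<close>

record ('f, 'r, 'm) lang =
  funs :: "'f set"
  rels :: "'r set"
  farity :: "'f \<Rightarrow> 'm"
  rarity :: "'r \<Rightarrow> 'm"

definition mu_ary_lang :: "'m rel \<Rightarrow> ('f, 'r, 'm) lang \<Rightarrow> bool" where
  "mu_ary_lang \<mu> L \<longleftrightarrow>
     (\<forall>f\<in>funs L. farity L f \<in> Field \<mu>) \<and> (\<forall>r\<in>rels L. rarity L r \<in> Field \<mu>)"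

text \<open>
  \<open>L \<subseteq> L\<^sub>1\<close>: the symbols of \<open>L\<close> occur in \<open>L\<^sub>1\<close> tagged by \<open>Inl\<close>; the summands \<open>'g\<close> and \<open>'s\<close>
  provide room for new symbols.
\<close>

definition sublang :: "('f, 'r, 'm) lang \<Rightarrow> ('f + 'g, 'r + 's, 'm) lang \<Rightarrow> bool" where
  "sublang L L\<^sub>1 \<longleftrightarrow>
     (\<forall>f\<in>funs L. Inl f \<in> funs L\<^sub>1 \<and> farity L\<^sub>1 (Inl f) = farity L f) \<and>
     (\<forall>r\<in>rels L. Inl r \<in> rels L\<^sub>1 \<and> rarity L\<^sub>1 (Inl r) = rarity L r)"

record ('f, 'r, 'm, 'a) struc =
  univ :: "'a set"
  fun_of :: "'f \<Rightarrow> ('m \<Rightarrow> 'a) \<Rightarrow> 'a"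
  rel_of :: "'r \<Rightarrow> ('m \<Rightarrow> 'a) set"

text \<open>
  The parameter \<open>\<U>\<close> is the collection of those subsets of the type \<open>'a\<close> that count as sets, as
  opposed to proper classes. Only sets are universes of structures. One can take \<open>\<U> = UNIV\<close>; if
  \<open>'a\<close> is a type of all ZF sets, then \<open>\<U>\<close> is the collection of the small subsets of \<open>'a\<close>, and a
  HOL set of structures is an arbitrary, possibly proper, class of structures.
\<close>

definition is_struc ::
  "'m rel \<Rightarrow> ('f, 'r, 'm) lang \<Rightarrow> 'a set set \<Rightarrow> ('f, 'r, 'm, 'a) struc \<Rightarrow> bool" where
  "is_struc \<mu> L \<U> M \<longleftrightarrow>
     univ M \<in> \<U> \<and>
     fun_of M \<in> (\<Pi>\<^sub>E f\<in>funs L. tuples \<mu> (farity L f) (univ M) \<rightarrow>\<^sub>E univ M) \<and>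
     (\<forall>r\<in>rels L. rel_of M r \<subseteq> tuples \<mu> (rarity L r) (univ M)) \<and>
     (\<forall>r. r \<notin> rels L \<longrightarrow> rel_of M r = {})"

definition substruc ::
  "'m rel \<Rightarrow> ('f, 'r, 'm) lang \<Rightarrow> ('f, 'r, 'm, 'a) struc \<Rightarrow> ('f, 'r, 'm, 'a) struc \<Rightarrow> bool" where
  "substruc \<mu> L M N \<longleftrightarrow>
     univ M \<subseteq> univ N \<and>
     (\<forall>f\<in>funs L. \<forall>t\<in>tuples \<mu> (farity L f) (univ M). fun_of M f t = fun_of N f t) \<and>
     (\<forall>r\<in>rels L. rel_of M r = rel_of N r \<inter> tuples \<mu> (rarity L r) (univ M))"

definition is_iso ::
  "'m rel \<Rightarrow> ('f, 'r, 'm) lang \<Rightarrow> ('a \<Rightarrow> 'a) \<Rightarrow>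
    ('f, 'r, 'm, 'a) struc \<Rightarrow> ('f, 'r, 'm, 'a) struc \<Rightarrow> bool" where
  "is_iso \<mu> L h M N \<longleftrightarrow>
     bij_betw h (univ M) (univ N) \<and>
     (\<forall>f\<in>funs L. \<forall>t\<in>tuples \<mu> (farity L f) (univ M).
        h (fun_of M f t) = fun_of N f (compose (underS \<mu> (farity L f)) h t)) \<and>
     (\<forall>r\<in>rels L. \<forall>t\<in>tuples \<mu> (rarity L r) (univ M).
        t \<in> rel_of M r \<longleftrightarrow> compose (underS \<mu> (rarity L r)) h t \<in> rel_of N r)"

text \<open>The image \<open>h[M]\<close> of \<open>M\<close> under a map \<open>h\<close> that is injective on the universe of \<open>M\<close>.\<close>

definition image_struc ::
  "'m rel \<Rightarrow> ('f, 'r, 'm) lang \<Rightarrow> ('a \<Rightarrow> 'a) \<Rightarrow>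
    ('f, 'r, 'm, 'a) struc \<Rightarrow> ('f, 'r, 'm, 'a) struc" where
  "image_struc \<mu> L h M =
     \<lparr>univ = h ` univ M,
      fun_of = (\<lambda>f\<in>funs L. \<lambda>t\<in>tuples \<mu> (farity L f) (h ` univ M).
        h (fun_of M f (compose (underS \<mu> (farity L f)) (inv_into (univ M) h) t))),
      rel_of = (\<lambda>r. if r \<in> rels L
        then compose (underS \<mu> (rarity L r)) h ` rel_of M r else {})\<rparr>"

text \<open>
  The union of a \<open>\<mu>\<close>-directed system of structures; the value picked by \<open>THE\<close> is then unique,
  since every tuple from the union of the universes is a tuple from one of them.
\<close>

definition union_struc ::
  "'m rel \<Rightarrow> ('f, 'r, 'm) lang \<Rightarrow> 'i set \<Rightarrow> ('i \<Rightarrow> ('f, 'r, 'm, 'a) struc) \<Rightarrow>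
    ('f, 'r, 'm, 'a) struc" where
  "union_struc \<mu> L I M =
     \<lparr>univ = (\<Union>i\<in>I. univ (M i)),
      fun_of = (\<lambda>f\<in>funs L. \<lambda>t\<in>tuples \<mu> (farity L f) (\<Union>i\<in>I. univ (M i)).
        THE y. \<exists>i\<in>I. t \<in> tuples \<mu> (farity L f) (univ (M i)) \<and> y = fun_of (M i) f t),
      rel_of = (\<lambda>r. \<Union>i\<in>I. rel_of (M i) r)\<rparr>"

definition reduct ::
  "('f, 'r, 'm) lang \<Rightarrow> ('f + 'g, 'r + 's, 'm, 'a) struc \<Rightarrow> ('f, 'r, 'm, 'a) struc" where
  "reduct L M =
     \<lparr>univ = univ M,
      fun_of = (\<lambda>f\<in>funs L. fun_of M (Inl f)),
      rel_of = (\<lambda>r. if r \<in> rels L then rel_of M (Inl r) else {})\<rparr>"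


section \<open>Abstract elementary classes\<close>

definition mu_abstract_class ::
  "'m rel \<Rightarrow> ('f, 'r, 'm) lang \<Rightarrow> 'a set set \<Rightarrow> ('f, 'r, 'm, 'a) struc set \<Rightarrow>
    (('f, 'r, 'm, 'a) struc \<Rightarrow> ('f, 'r, 'm, 'a) struc \<Rightarrow> bool) \<Rightarrow> bool" where
  "mu_abstract_class \<mu> L \<U> K le \<longleftrightarrow>
     mu_ary_lang \<mu> L \<and>
     (\<forall>M\<in>K. is_struc \<mu> L \<U> M) \<and>
     (\<forall>M N. le M N \<longrightarrow> M \<in> K \<and> N \<in> K \<and> substruc \<mu> L M N) \<and>
     (\<forall>M\<in>K. le M M) \<and>
     (\<forall>M N P. le M N \<longrightarrow> le N P \<longrightarrow> le M P) \<and>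
     (\<forall>h N N'. N \<in> K \<longrightarrow> is_struc \<mu> L \<U> N' \<longrightarrow> is_iso \<mu> L h N N' \<longrightarrow>
        N' \<in> K \<and>
        (\<forall>M. le M N \<longrightarrow> image_struc \<mu> L h M \<in> K \<and> le (image_struc \<mu> L h M) N'))"

definition mu_directed :: "'m rel \<Rightarrow> 'i set \<Rightarrow> 'i rel \<Rightarrow> bool" where
  "mu_directed \<mu> I r \<longleftrightarrow>
     partial_order_on I r \<and> (\<forall>A. A \<subseteq> I \<and> |A| <o \<mu> \<longrightarrow> (\<exists>b\<in>I. \<forall>a\<in>A. (a, b) \<in> r))"

definition coherence ::
  "'m rel \<Rightarrow> ('f, 'r, 'm) lang \<Rightarrow> ('f, 'r, 'm, 'a) struc set \<Rightarrow>
    (('f, 'r, 'm, 'a) struc \<Rightarrow> ('f, 'r, 'm, 'a) struc \<Rightarrow> bool) \<Rightarrow> bool" where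
  "coherence \<mu> L K le \<longleftrightarrow>
     (\<forall>M\<^sub>0\<in>K. \<forall>M\<^sub>1\<in>K. \<forall>M\<^sub>2\<in>K.
        le M\<^sub>0 M\<^sub>2 \<longrightarrow> le M\<^sub>1 M\<^sub>2 \<longrightarrow> substruc \<mu> L M\<^sub>0 M\<^sub>1 \<longrightarrow> le M\<^sub>0 M\<^sub>1)"

text \<open>
  It is no restriction that the elements of the index set are of the type of structures: an
  arbitrary index set can be replaced by the set of the structures \<open>M i\<close>, ordered by \<open>le\<close>.
  The premise on \<open>\<U>\<close> says that the union is a set.
\<close>

definition tarski_vaught ::
  "'m rel \<Rightarrow> ('f, 'r, 'm) lang \<Rightarrow> 'a set set \<Rightarrow> ('f, 'r, 'm, 'a) struc set \<Rightarrow>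
    (('f, 'r, 'm, 'a) struc \<Rightarrow> ('f, 'r, 'm, 'a) struc \<Rightarrow> bool) \<Rightarrow> bool" where
  "tarski_vaught \<mu> L \<U> K le \<longleftrightarrow>
     (\<forall>(I :: ('f, 'r, 'm, 'a) struc set) r M.
        mu_directed \<mu> I r \<longrightarrow> (\<forall>i\<in>I. M i \<in> K) \<longrightarrow>
        (\<forall>i\<in>I. \<forall>j\<in>I. (i, j) \<in> r \<longrightarrow> le (M i) (M j)) \<longrightarrow>
        (\<Union>i\<in>I. univ (M i)) \<in> \<U> \<longrightarrow>
        union_struc \<mu> L I M \<in> K \<and>
        (\<forall>j\<in>I. le (M j) (union_struc \<mu> L I M)) \<and>
        (\<forall>N\<in>K. (\<forall>i\<in>I. le (M i) N) \<longrightarrow> le (union_struc \<mu> L I M) N))"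

definition lst_cardinal ::
  "'m rel \<Rightarrow> ('f, 'r, 'm) lang \<Rightarrow> ('f, 'r, 'm, 'a) struc set \<Rightarrow>
    (('f, 'r, 'm, 'a) struc \<Rightarrow> ('f, 'r, 'm, 'a) struc \<Rightarrow> bool) \<Rightarrow> 'c rel \<Rightarrow> bool" where
  "lst_cardinal \<mu> L K le \<kappa> \<longleftrightarrow>
     Card_order \<kappa> \<and>
     |short_tuples \<mu> (Field \<kappa>)| =o \<kappa> \<and>
     |funs L <+> rels L| +c \<mu> \<le>o \<kappa> \<and>
     (\<forall>M\<in>K. \<forall>A. A \<subseteq> univ M \<longrightarrow>
        (\<exists>N. le N M \<and> A \<subseteq> univ N \<and> |univ N| \<le>o |short_tuples \<mu> A| +c \<kappa>))"

text \<open>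
  The type argument says where the cardinal of the Loewenheim-Skolem-Tarski axiom lives. The
  regularity of \<open>\<mu>\<close> is part of the definition.
\<close>

definition mu_AEC ::
  "'c itself \<Rightarrow> 'm rel \<Rightarrow> ('f, 'r, 'm) lang \<Rightarrow> 'a set set \<Rightarrow> ('f, 'r, 'm, 'a) struc set \<Rightarrow>
    (('f, 'r, 'm, 'a) struc \<Rightarrow> ('f, 'r, 'm, 'a) struc \<Rightarrow> bool) \<Rightarrow> bool" where
  "mu_AEC (_ :: 'c itself) \<mu> L \<U> K le \<longleftrightarrow>
     Cinfinite \<mu> \<and> regularCard \<mu> \<and>
     mu_abstract_class \<mu> L \<U> K le \<and>
     coherence \<mu> L K le \<and>
     tarski_vaught \<mu> L \<U> K le \<and>
     (\<exists>\<kappa> :: 'c rel. lst_cardinal \<mu> L K le \<kappa>)"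

text \<open>
  Being an \<open>lst_cardinal\<close> is invariant under \<open>=o\<close>, and every cardinal below \<open>\<chi>\<close> has a
  representative on the type of \<open>\<chi>\<close>; so \<open>\<chi>\<close> is the least one among the cardinals on all types.
\<close>

definition is_LS ::
  "'m rel \<Rightarrow> ('f, 'r, 'm) lang \<Rightarrow> ('f, 'r, 'm, 'a) struc set \<Rightarrow>
    (('f, 'r, 'm, 'a) struc \<Rightarrow> ('f, 'r, 'm, 'a) struc \<Rightarrow> bool) \<Rightarrow> 'c rel \<Rightarrow> bool" where
  "is_LS \<mu> L K le \<chi> \<longleftrightarrow>
     lst_cardinal \<mu> L K le \<chi> \<and> (\<forall>\<kappa> :: 'c rel. lst_cardinal \<mu> L K le \<kappa> \<longrightarrow> \<chi> \<le>o \<kappa>)"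


section \<open>The logic \<open>L\<^sub>\<mu>\<^sub>,\<^sub>\<mu>\<close>\<close>

text \<open>
  The variables are the elements of \<open>Field \<mu>\<close>. \<open>Conj \<alpha> \<Phi>\<close> is the conjunction of the formulas
  \<open>\<Phi> \<beta>\<close> for \<open>\<beta> < \<alpha>\<close>, and \<open>Exs X \<phi>\<close> quantifies over all variables in \<open>X\<close> at once. Disjunction and
  universal quantification are expressed through negation.
\<close>

datatype ('f, 'm) trm = Var 'm | Fn 'f "'m \<Rightarrow> ('f, 'm) trm"

datatype ('f, 'r, 'm) fm =
    Eq "('f, 'm) trm" "('f, 'm) trm"
  | Rl 'r "'m \<Rightarrow> ('f, 'm) trm"
  | Neg "('f, 'r, 'm) fm"
  | Conj 'm "'m \<Rightarrow> ('f, 'r, 'm) fm"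
  | Exs "'m set" "('f, 'r, 'm) fm"

primrec is_trm :: "'m rel \<Rightarrow> ('f, 'r, 'm) lang \<Rightarrow> ('f, 'm) trm \<Rightarrow> bool" where
  "is_trm \<mu> L (Var x) \<longleftrightarrow> x \<in> Field \<mu>"
| "is_trm \<mu> L (Fn f ts) \<longleftrightarrow>
     f \<in> funs L \<and> ts \<in> extensional (underS \<mu> (farity L f)) \<and>
     (\<forall>i\<in>underS \<mu> (farity L f). is_trm \<mu> L (ts i))"

primrec is_fm :: "'m rel \<Rightarrow> ('f, 'r, 'm) lang \<Rightarrow> ('f, 'r, 'm) fm \<Rightarrow> bool" where
  "is_fm \<mu> L (Eq s t) \<longleftrightarrow> is_trm \<mu> L s \<and> is_trm \<mu> L t"
| "is_fm \<mu> L (Rl r ts) \<longleftrightarrow>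
     r \<in> rels L \<and> ts \<in> extensional (underS \<mu> (rarity L r)) \<and>
     (\<forall>i\<in>underS \<mu> (rarity L r). is_trm \<mu> L (ts i))"
| "is_fm \<mu> L (Neg \<phi>) \<longleftrightarrow> is_fm \<mu> L \<phi>"
| "is_fm \<mu> L (Conj \<alpha> \<Phi>) \<longleftrightarrow>
     \<alpha> \<in> Field \<mu> \<and> \<Phi> \<in> extensional (underS \<mu> \<alpha>) \<and> (\<forall>\<beta>\<in>underS \<mu> \<alpha>. is_fm \<mu> L (\<Phi> \<beta>))"
| "is_fm \<mu> L (Exs X \<phi>) \<longleftrightarrow> X \<subseteq> Field \<mu> \<and> |X| <o \<mu> \<and> is_fm \<mu> L \<phi>"

primrec trm_vars :: "'m rel \<Rightarrow> ('f, 'r, 'm) lang \<Rightarrow> ('f, 'm) trm \<Rightarrow> 'm set" where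
  "trm_vars \<mu> L (Var x) = {x}"
| "trm_vars \<mu> L (Fn f ts) = (\<Union>i\<in>underS \<mu> (farity L f). trm_vars \<mu> L (ts i))"

primrec free_vars :: "'m rel \<Rightarrow> ('f, 'r, 'm) lang \<Rightarrow> ('f, 'r, 'm) fm \<Rightarrow> 'm set" where
  "free_vars \<mu> L (Eq s t) = trm_vars \<mu> L s \<union> trm_vars \<mu> L t"
| "free_vars \<mu> L (Rl r ts) = (\<Union>i\<in>underS \<mu> (rarity L r). trm_vars \<mu> L (ts i))"
| "free_vars \<mu> L (Neg \<phi>) = free_vars \<mu> L \<phi>"
| "free_vars \<mu> L (Conj \<alpha> \<Phi>) = (\<Union>\<beta>\<in>underS \<mu> \<alpha>. free_vars \<mu> L (\<Phi> \<beta>))"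
| "free_vars \<mu> L (Exs X \<phi>) = free_vars \<mu> L \<phi> - X"

primrec trm_val ::
  "'m rel \<Rightarrow> ('f, 'r, 'm) lang \<Rightarrow> ('f, 'r, 'm, 'a) struc \<Rightarrow> ('m \<Rightarrow> 'a) \<Rightarrow> ('f, 'm) trm \<Rightarrow> 'a" where
  "trm_val \<mu> L M v (Var x) = v x"
| "trm_val \<mu> L M v (Fn f ts) =
     fun_of M f (\<lambda>i\<in>underS \<mu> (farity L f). trm_val \<mu> L M v (ts i))"

primrec sat ::
  "'m rel \<Rightarrow> ('f, 'r, 'm) lang \<Rightarrow> ('f, 'r, 'm, 'a) struc \<Rightarrow> ('f, 'r, 'm) fm \<Rightarrow> ('m \<Rightarrow> 'a) \<Rightarrow> bool" where
  "sat \<mu> L M (Eq s t) v \<longleftrightarrow> trm_val \<mu> L M v s = trm_val \<mu> L M v t"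
| "sat \<mu> L M (Rl r ts) v \<longleftrightarrow>
     (\<lambda>i\<in>underS \<mu> (rarity L r). trm_val \<mu> L M v (ts i)) \<in> rel_of M r"
| "sat \<mu> L M (Neg \<phi>) v \<longleftrightarrow> \<not> sat \<mu> L M \<phi> v"
| "sat \<mu> L M (Conj \<alpha> \<Phi>) v \<longleftrightarrow> (\<forall>\<beta>\<in>underS \<mu> \<alpha>. sat \<mu> L M (\<Phi> \<beta>) v)"
| "sat \<mu> L M (Exs X \<phi>) v \<longleftrightarrow>
     (\<exists>w. w ` X \<subseteq> univ M \<and> sat \<mu> L M \<phi> (\<lambda>x. if x \<in> X then w x else v x))"

definition is_theory :: "'m rel \<Rightarrow> ('f, 'r, 'm) lang \<Rightarrow> ('f, 'r, 'm) fm set \<Rightarrow> bool" where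
  "is_theory \<mu> L T \<longleftrightarrow> (\<forall>\<phi>\<in>T. is_fm \<mu> L \<phi> \<and> free_vars \<mu> L \<phi> = {})"

text \<open>
  The truth value of a sentence does not depend on \<open>v\<close>. As \<open>v\<close> is not required to take values in
  the universe, the quantifier is not vacuous for a structure with empty universe.
\<close>

definition models ::
  "'m rel \<Rightarrow> ('f, 'r, 'm) lang \<Rightarrow> ('f, 'r, 'm, 'a) struc \<Rightarrow> ('f, 'r, 'm) fm set \<Rightarrow> bool" where
  "models \<mu> L M T \<longleftrightarrow> (\<forall>\<phi>\<in>T. \<forall>v. sat \<mu> L M \<phi> v)"

text \<open>A type \<open>(X, p)\<close> is a set \<open>p\<close> of formulas in the free variables \<open>X\<close>.\<close>

definition is_type ::
  "'m rel \<Rightarrow> ('f, 'r, 'm) lang \<Rightarrow> 'm set \<times> ('f, 'r, 'm) fm set \<Rightarrow> bool" where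
  "is_type \<mu> L = (\<lambda>(X, p). X \<subseteq> Field \<mu> \<and> |X| <o \<mu> \<and>
     (\<forall>\<phi>\<in>p. is_fm \<mu> L \<phi> \<and> free_vars \<mu> L \<phi> \<subseteq> X))"

definition omits ::
  "'m rel \<Rightarrow> ('f, 'r, 'm) lang \<Rightarrow> ('f, 'r, 'm, 'a) struc \<Rightarrow> 'm set \<times> ('f, 'r, 'm) fm set \<Rightarrow> bool" where
  "omits \<mu> L M = (\<lambda>(X, p). \<not> (\<exists>v. v ` X \<subseteq> univ M \<and> (\<forall>\<phi>\<in>p. sat \<mu> L M \<phi> v)))"

definition EC ::
  "'m rel \<Rightarrow> ('f, 'r, 'm) lang \<Rightarrow> 'a set set \<Rightarrow> ('f, 'r, 'm) fm set \<Rightarrow>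
    ('m set \<times> ('f, 'r, 'm) fm set) set \<Rightarrow> ('f, 'r, 'm, 'a) struc set" where
  "EC \<mu> L \<U> T \<Gamma> = {M. is_struc \<mu> L \<U> M \<and> models \<mu> L M T \<and> (\<forall>p\<in>\<Gamma>. omits \<mu> L M p)}"

definition PC ::
  "'m rel \<Rightarrow> ('f + 'g, 'r + 's, 'm) lang \<Rightarrow> 'a set set \<Rightarrow> ('f + 'g, 'r + 's, 'm) fm set \<Rightarrow>
    ('m set \<times> ('f + 'g, 'r + 's, 'm) fm set) set \<Rightarrow> ('f, 'r, 'm) lang \<Rightarrow>
    ('f, 'r, 'm, 'a) struc set" where
  "PC \<mu> L\<^sub>1 \<U> T \<Gamma> L = reduct L ` EC \<mu> L\<^sub>1 \<U> T \<Gamma>"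

end

theory Submission
  imports Defs
begin

text \<open>
  The language \<open>L\<^sub>1\<close> adds \<open>\<chi>\<close> function symbols of every nonzero arity. In an \<open>L\<^sub>1\<close>-structure, a tuple
  \<open>b\<close> of length \<open>\<beta>\<close> generates the set of the values at \<open>b\<close> of all new functions of arity \<open>\<beta>\<close>. In a good
  structure these sets carry strong submodels of size at most \<open>\<chi>\<close> that contain the entries of \<open>b\<close> and
  grow when \<open>b\<close> is replaced by a strictly longer tuple with more entries. Every \<open>M \<in> K\<close> has a good
  expansion, by recursion on the length of the tuple. Recursion on the set of entries would
  not be well-founded if \<open>\<mu>\<close> is uncountable; with lengths the system is still \<open>\<mu>\<close>-directed, because
  a tuple can be made longer by repeating entries.

  The types to be omitted are the sets of atomic and negated atomic formulas (of a certain shape)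
  that no tuple in a good structure realizes. In a structure omitting them,
  every tuple looks like a tuple in a good structure, so the generated sets carry isomorphic copies of
  models in \<open>K\<close> with the same strong inclusions, and the Tarski-Vaught axiom puts their union in \<open>K\<close>.
\<close>

section \<open>Cardinals and tuples\<close>

text \<open>By regularity a set of fewer than \<mu> ordinals is not cofinal, so some
  \<open>a\<close> bounds it weakly. An infinite cardinal has no last element, and any
  \<open>\<beta>\<close> above \<open>a\<close> is a strict bound.\<close>

lemma Card_order_bounded:
  assumes \<mu>: "Cinfinite \<mu>" "regularCard \<mu>" and G: "G \<subseteq> Field \<mu>" "|G| <o \<mu>"
  obtains \<beta> where "\<beta> \<in> Field \<mu>" "G \<subseteq> underS \<mu> \<beta>"
proof -
  have co: "Card_order \<mu>" and inf: "\<not> finite (Field \<mu>)"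
    using \<mu> by (auto simp: cinfinite_def)
  then have wo: "wo_rel \<mu>"
    by (simp add: wo_rel_def card_order_on_def)
  have "\<not> cofinal G \<mu>"
  proof
    assume "cofinal G \<mu>"
    with \<mu>(2) G(1) have "|G| =o \<mu>"
      by (simp add: regularCard_def)
    with G(2) show False
      using not_ordLess_ordIso by blast
  qed
  then obtain a where a: "a \<in> Field \<mu>" "\<And>b. b \<in> G \<Longrightarrow> a = b \<or> (a, b) \<notin> \<mu>"
    unfolding cofinal_def by blast
  obtain \<beta> where \<beta>: "\<beta> \<in> Field \<mu>" "a \<noteq> \<beta>" "(a, \<beta>) \<in> \<mu>"
    using infinite_Card_order_limit[OF co inf a(1)] by blast
  have "b \<in> underS \<mu> \<beta>" if "b \<in> G" for b
  proof -
    have "b \<in> Field \<mu>"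
      using G(1) that by blast
    with a(1) have "(a, b) \<in> \<mu> \<or> (b, a) \<in> \<mu>"
      using wo_rel.TOTALS[OF wo] by blast
    with a(2)[OF that] \<open>b \<in> Field \<mu>\<close> have "(b, a) \<in> \<mu>"
      using wo_rel.REFL[OF wo] by (auto simp: refl_on_def)
    then have "(b, \<beta>) \<in> \<mu>"
      using transD[OF wo_rel.TRANS[OF wo] _ \<beta>(3)] by blast
    moreover have "b \<noteq> \<beta>"
      using antisymD[OF wo_rel.ANTISYM[OF wo] \<open>(b, a) \<in> \<mu>\<close>] \<beta> by blast
    ultimately show ?thesis
      by (simp add: underS_def)
  qed
  with \<beta>(1) that show ?thesis by blast
qed

lemma underS_mono:
  assumes "Card_order \<mu>" "\<gamma> \<in> underS \<mu> \<beta>"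
  shows "underS \<mu> \<gamma> \<subseteq> underS \<mu> \<beta>"
proof -
  have wo: "wo_rel \<mu>"
    using assms by (simp add: wo_rel_def card_order_on_def)
  have \<gamma>: "(\<gamma>, \<beta>) \<in> \<mu>" "\<gamma> \<noteq> \<beta>"
    using assms(2) by (auto simp: underS_def)
  show ?thesis
    using transD[OF wo_rel.TRANS[OF wo] _ \<gamma>(1)] antisymD[OF wo_rel.ANTISYM[OF wo] \<gamma>(1)] \<gamma>(2)
    by (auto simp: underS_def)
qed

text \<open>An order strictly below a well-order is isomorphic to the restriction of that well-order
  to a proper initial segment.\<close>

lemma card_le_underS:
  assumes "Card_order \<mu>" "|B| <o \<mu>"
  obtains \<gamma> where "\<gamma> \<in> Field \<mu>" "|B| \<le>o |underS \<mu> \<gamma>|"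
proof -
  have wo: "Well_order \<mu>"
    using assms by (simp add: card_order_on_def)
  obtain \<gamma> where \<gamma>: "\<gamma> \<in> Field \<mu>" "|B| =o Restr \<mu> (underS \<mu> \<gamma>)"
    using assms(2) ordLess_iff_ordIso_Restr[OF wo card_of_Well_order] by blast
  then have "|Field |B| | \<le>o |Field (Restr \<mu> (underS \<mu> \<gamma>))|"
    using card_of_mono2 ordIso_iff_ordLeq by blast
  then have "|B| \<le>o |Field (Restr \<mu> (underS \<mu> \<gamma>))|"
    by (simp only: Field_card_of)
  moreover have "Field (Restr \<mu> (underS \<mu> \<gamma>)) \<subseteq> underS \<mu> \<gamma>"
    by (auto simp: Field_def)
  ultimately show ?thesis
    using that \<gamma>(1) card_of_mono1 ordLeq_transitive by blast
qed

lemma card_singleton_less: "Cinfinite \<mu> \<Longrightarrow> |{x}| <o \<mu>"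
  by (intro Cfinite_ordLess_Cinfinite)
    (auto simp: cfinite_def card_of_card_order_on Field_card_of)

lemma card_Pow_mono:
  assumes "|A| \<le>o |B|"
  shows "|Pow A| \<le>o |Pow B|"
proof -
  obtain h where "inj_on h A" "h ` A \<subseteq> B"
    using iffD2[OF card_of_ordLeq assms] by blast
  then have "\<exists>f. inj_on f (Pow A) \<and> f ` Pow A \<subseteq> Pow B"
    using inj_on_image_Pow image_Pow_mono by blast
  then show ?thesis
    by (rule iffD1[OF card_of_ordLeq])
qed

text \<open>A surjection onto \<open>B\<close> may repeat values, so its domain can be taken as long
  as desired. Regularity supplies a length above all of \<open>G\<close> and above an ordinal of
  size at least \<open>|B|\<close>.\<close>

lemma long_tuple:
  assumes \<mu>: "Cinfinite \<mu>" "regularCard \<mu>"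
    and B: "B \<subseteq> A" "B \<noteq> {}" "|B| <o \<mu>"
    and G: "G \<subseteq> Field \<mu>" "|G| <o \<mu>"
  obtains \<beta> b where "\<beta> \<in> Field \<mu>" "G \<subseteq> underS \<mu> \<beta>" "b \<in> tuples \<mu> \<beta> A" "b ` underS \<mu> \<beta> = B"
proof -
  obtain \<gamma> where \<gamma>: "\<gamma> \<in> Field \<mu>" "|B| \<le>o |underS \<mu> \<gamma>|"
    using card_le_underS \<mu> B(3) by blast
  have "|G \<union> {\<gamma>}| <o \<mu>"
    using Un_Cinfinite_bound_strict[OF G(2) card_singleton_less[OF \<mu>(1)] \<mu>(1)] .
  then obtain \<beta> where \<beta>: "\<beta> \<in> Field \<mu>" "G \<union> {\<gamma>} \<subseteq> underS \<mu> \<beta>"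
    using Card_order_bounded[OF \<mu>, of "G \<union> {\<gamma>}"] G(1) \<gamma>(1) by blast
  have "|B| \<le>o |underS \<mu> \<beta>|"
    using \<gamma>(2) underS_mono[of \<mu> \<gamma> \<beta>] \<mu>(1) \<beta>(2) card_of_mono1 ordLeq_transitive by blast
  with card_of_ordLeq2[OF B(2)] have "\<exists>g. g ` underS \<mu> \<beta> = B"
    by (rule iffD2)
  then obtain g where g: "g ` underS \<mu> \<beta> = B" ..
  show ?thesis
    by (rule that[of \<beta> "restrict g (underS \<mu> \<beta>)"]) (use \<beta> g B(1) in \<open>auto simp: tuples_def\<close>)
qed

text \<open>An injection of \<open>A\<close> into \<open>B\<close> acts entrywise and keeps the
  length; beyond the length, tuples agree by extensionality.\<close>

lemma short_tuples_mono:
  assumes "|A| \<le>o |B|"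
  shows "|short_tuples \<mu> A| \<le>o |short_tuples \<mu> B|"
proof -
  obtain h where h: "inj_on h A" "h ` A \<subseteq> B"
    using iffD2[OF card_of_ordLeq assms] by blast
  define H where "H = (\<lambda>(\<alpha>, t). (\<alpha>, compose (underS \<mu> \<alpha>) h t))"
  have "inj_on H (short_tuples \<mu> A)"
  proof (rule inj_onI)
    fix x y
    assume x: "x \<in> short_tuples \<mu> A" and y: "y \<in> short_tuples \<mu> A" and eq: "H x = H y"
    obtain \<alpha> s t where xy: "x = (\<alpha>, s)" "y = (\<alpha>, t)"
      using eq by (cases x; cases y) (auto simp: H_def)
    have st: "s \<in> underS \<mu> \<alpha> \<rightarrow>\<^sub>E A" "t \<in> underS \<mu> \<alpha> \<rightarrow>\<^sub>E A"
      using x y by (auto simp: xy short_tuples_def tuples_def)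
    have "s i = t i" for i
    proof (cases "i \<in> underS \<mu> \<alpha>")
      case True
      then have "h (s i) = h (t i)"
        using eq by (auto simp: xy H_def compose_def restrict_def dest: fun_cong[of _ _ i])
      then show ?thesis
        using True st h(1) by (auto dest: inj_onD)
    next
      case False
      then show ?thesis
        using PiE_arb[OF st(1)] PiE_arb[OF st(2)] by simp
    qed
    then show "x = y" by (auto simp: xy)
  qed
  moreover have "H ` short_tuples \<mu> A \<subseteq> short_tuples \<mu> B"
    by (auto simp: H_def short_tuples_def tuples_def compose_def intro!: subsetD[OF h(2)])
  ultimately show ?thesis
    using iffD1[OF card_of_ordLeq] by blast
qed

section \<open>Induced substructures and satisfaction\<close>

text \<open>The set \<open>A\<close> need not be closed under the functions, so the result need not
  be a structure. Being defined for every \<open>A\<close>, it allows submodels to be handled as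
  plain sets.\<close>

definition restr ::
  "'m rel \<Rightarrow> ('f, 'r, 'm) lang \<Rightarrow> ('f, 'r, 'm, 'a) struc \<Rightarrow> 'a set \<Rightarrow> ('f, 'r, 'm, 'a) struc" where
  "restr \<mu> L M A =
     \<lparr>univ = A,
      fun_of = (\<lambda>f\<in>funs L. \<lambda>t\<in>tuples \<mu> (farity L f) A. fun_of M f t),
      rel_of = (\<lambda>r. if r \<in> rels L then rel_of M r \<inter> tuples \<mu> (rarity L r) A else {})\<rparr>"

lemma univ_restr [simp]: "univ (restr \<mu> L M A) = A"
  by (simp add: restr_def)

lemma univ_reduct [simp]: "univ (reduct L M) = univ M"
  by (simp add: reduct_def)

lemma tuples_mono: "A \<subseteq> B \<Longrightarrow> tuples \<mu> \<alpha> A \<subseteq> tuples \<mu> \<alpha> B"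
  unfolding tuples_def by (rule PiE_mono) simp

text \<open>Functions are extensional and relations vanish outside the language, so a substructure
  carries no data besides its universe.\<close>

lemma substruc_eq_restr:
  fixes N :: "('f, 'r, 'm, 'a) struc"
  assumes "is_struc \<mu> L \<U> N" "substruc \<mu> L N M"
  shows "N = restr \<mu> L M (univ N)"
proof (rule struc.equality)
  have N: "fun_of N \<in> (\<Pi>\<^sub>E f\<in>funs L. tuples \<mu> (farity L f) (univ N) \<rightarrow>\<^sub>E univ N)"
    using assms(1) by (simp add: is_struc_def)
  show "fun_of N = fun_of (restr \<mu> L M (univ N))"
  proof (intro ext)
    fix f t
    show "fun_of N f t = fun_of (restr \<mu> L M (univ N)) f t"
    proof (cases "f \<in> funs L")
      case True
      with N have "fun_of N f \<in> tuples \<mu> (farity L f) (univ N) \<rightarrow>\<^sub>E univ N"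
        by auto
      then show ?thesis
        using True assms(2) PiE_arb[of "fun_of N f"]
        by (cases "t \<in> tuples \<mu> (farity L f) (univ N)") (auto simp: restr_def substruc_def)
    next
      case False
      then have "fun_of N f = undefined"
        by (rule PiE_arb[OF N])
      then show ?thesis
        using False by (simp add: restr_def)
    qed
  qed
  show "rel_of N = rel_of (restr \<mu> L M (univ N))"
    using assms by (auto simp: fun_eq_iff restr_def substruc_def is_struc_def)
qed (simp_all add: restr_def)

lemma is_struc_restr:
  assumes "A \<in> \<U>"
    and "\<And>f t. f \<in> funs L \<Longrightarrow> t \<in> tuples \<mu> (farity L f) A \<Longrightarrow> fun_of M f t \<in> A"
  shows "is_struc \<mu> L \<U> (restr \<mu> L M A)"
  using assms by (auto simp: is_struc_def restr_def)

lemma substruc_restr: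
  assumes "A \<subseteq> univ M"
  shows "substruc \<mu> L (restr \<mu> L M A) M"
  using assms by (auto simp: substruc_def restr_def)

lemma substruc_restr_restr:
  assumes "A \<subseteq> B"
  shows "substruc \<mu> L (restr \<mu> L M A) (restr \<mu> L M B)"
  using assms tuples_mono[OF assms, of \<mu>] by (fastforce simp: substruc_def restr_def)

lemma restr_univ:
  assumes "is_struc \<mu> L \<U> M"
  shows "restr \<mu> L M (univ M) = M"
proof -
  have "substruc \<mu> L M M"
    using assms by (auto simp: substruc_def is_struc_def)
  from substruc_eq_restr[OF assms this] show ?thesis ..
qed

lemma restr_restr:
  assumes "A \<subseteq> B"
  shows "restr \<mu> L (restr \<mu> L M B) A = restr \<mu> L M A"
proof (rule struc.equality)
  have t: "t \<in> tuples \<mu> \<alpha> B" if "t \<in> tuples \<mu> \<alpha> A" for t \<alpha>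
    using subsetD[OF tuples_mono[OF assms] that] .
  show "fun_of (restr \<mu> L (restr \<mu> L M B) A) = fun_of (restr \<mu> L M A)"
    by (auto simp: restr_def fun_eq_iff t)
  show "rel_of (restr \<mu> L (restr \<mu> L M B) A) = rel_of (restr \<mu> L M A)"
    by (auto simp: restr_def fun_eq_iff t)
qed simp_all

section \<open>Values and satisfaction under a change of assignment\<close>

lemma trm_val_cong:
  "\<forall>x\<in>trm_vars \<mu> L t. v x = w x \<Longrightarrow> trm_val \<mu> L M v t = trm_val \<mu> L M w t"
proof (induction t)
  case (Fn f ts)
  then have "trm_val \<mu> L M v (ts i) = trm_val \<mu> L M w (ts i)" if "i \<in> underS \<mu> (farity L f)" for i
    using that by auto
  then show ?case
    by (simp cong: restrict_cong)
qed simp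

lemma sat_cong:
  "\<forall>x\<in>free_vars \<mu> L \<phi>. v x = w x \<Longrightarrow> sat \<mu> L M \<phi> v \<longleftrightarrow> sat \<mu> L M \<phi> w"
proof (induction \<phi> arbitrary: v w)
  case (Eq s t)
  then show ?case
    using trm_val_cong[of \<mu> L s v w M] trm_val_cong[of \<mu> L t v w M] by simp
next
  case (Rl r ts)
  then have "trm_val \<mu> L M v (ts i) = trm_val \<mu> L M w (ts i)" if "i \<in> underS \<mu> (rarity L r)" for i
    using that by (intro trm_val_cong) auto
  then show ?case
    by (simp cong: restrict_cong)
next
  case (Neg \<phi>)
  then show ?case
    using Neg.IH[of v w] by simp
next
  case (Conj \<alpha> \<Phi>)
  have "sat \<mu> L M (\<Phi> \<beta>) v \<longleftrightarrow> sat \<mu> L M (\<Phi> \<beta>) w" if "\<beta> \<in> underS \<mu> \<alpha>" for \<beta>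
    using Conj.prems that by (intro Conj.IH) auto
  then show ?case
    by simp
next
  case (Exs X \<phi>)
  have "sat \<mu> L M \<phi> (\<lambda>x. if x \<in> X then u x else v x) \<longleftrightarrow>
    sat \<mu> L M \<phi> (\<lambda>x. if x \<in> X then u x else w x)" for u
    using Exs.prems by (intro Exs.IH) auto
  then show ?case
    by simp
qed

lemma is_struc_fun:
  assumes "is_struc \<mu> L \<U> M" "f \<in> funs L"
  shows "fun_of M f \<in> tuples \<mu> (farity L f) (univ M) \<rightarrow>\<^sub>E univ M"
  using assms by (auto simp: is_struc_def)

lemma is_struc_closed:
  assumes "is_struc \<mu> L \<U> M" "f \<in> funs L" "t \<in> tuples \<mu> (farity L f) (univ M)"
  shows "fun_of M f t \<in> univ M"
  using assms by (auto simp: is_struc_def)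

section \<open>The language, the theory and the types\<close>

text \<open>
  The map \<open>ar\<close> is the arity of the new function symbols. Arity \<open>0\<close> is excluded because no structure with
  empty universe interprets a constant, whereas \<open>K\<close> may contain such a structure.
\<close>

locale presentation =
  fixes \<mu> :: "'m rel"
    and L :: "('f, 'r, 'm) lang"
    and \<U> :: "'a set set"
    and K :: "('f, 'r, 'm, 'a) struc set"
    and le :: "('f, 'r, 'm, 'a) struc \<Rightarrow> ('f, 'r, 'm, 'a) struc \<Rightarrow> bool"
    and \<chi> :: "'c rel"
    and ar :: "'c \<Rightarrow> 'm"
  assumes small_sub: "X \<in> \<U> \<Longrightarrow> Y \<subseteq> X \<Longrightarrow> Y \<in> \<U>"
    and mu: "Cinfinite \<mu>" "regularCard \<mu>"
    and abs_class: "mu_abstract_class \<mu> L \<U> K le"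
    and coh: "coherence \<mu> L K le"
    and tv: "tarski_vaught \<mu> L \<U> K le"
    and lst: "lst_cardinal \<mu> L K le \<chi>"
    and ar: "c \<in> Field \<chi> \<Longrightarrow> ar c \<in> Field \<mu>" "c \<in> Field \<chi> \<Longrightarrow> underS \<mu> (ar c) \<noteq> {}"
    and ar_fiber: "\<beta> \<in> Field \<mu> \<Longrightarrow> underS \<mu> \<beta> \<noteq> {} \<Longrightarrow> \<chi> \<le>o |{c \<in> Field \<chi>. ar c = \<beta>}|"
begin

definition L\<^sub>1 :: "('f + 'c, 'r + 'c, 'm) lang" where
  "L\<^sub>1 = \<lparr>funs = funs L <+> Field \<chi>, rels = Inl ` rels L,
     farity = case_sum (farity L) ar, rarity = case_sum (rarity L) undefined\<rparr>"

text \<open>With \<chi> symbols of each nonzero arity, the values at \<open>b\<close> can enumerate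
  any nonempty set of size at most \<chi>; a whole submodel is thus named by terms in
  \<open>b\<close>.\<close>

definition hull :: "('f + 'c, 'r + 'c, 'm, 'a) struc \<Rightarrow> 'm \<Rightarrow> ('m \<Rightarrow> 'a) \<Rightarrow> 'a set" where
  "hull M \<beta> b = {fun_of M (Inr c) b | c. c \<in> Field \<chi> \<and> ar c = \<beta>}"

abbreviation sub_hull where
  "sub_hull M \<beta> b \<equiv> restr \<mu> L (reduct L M) (hull M \<beta> b)"

text \<open>Subtuples of \<open>b\<close> are given by index maps \<open>\<sigma>\<close>. An index
  map does not mention the structure, so it selects corresponding subtuples in different
  structures.\<close>

abbreviation tcomp :: "'m \<Rightarrow> ('x \<Rightarrow> 'b) \<Rightarrow> ('m \<Rightarrow> 'x) \<Rightarrow> 'm \<Rightarrow> 'b" where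
  "tcomp \<gamma> b \<sigma> \<equiv> compose (underS \<mu> \<gamma>) b \<sigma>"

text \<open>Monotonicity is demanded only as an inclusion of sets; coherence turns it into
  \<open>le\<close>, since both hulls are strong in the reduct.\<close>

definition good :: "('f + 'c, 'r + 'c, 'm, 'a) struc \<Rightarrow> bool" where
  "good M \<longleftrightarrow> is_struc \<mu> L\<^sub>1 \<U> M \<and> reduct L M \<in> K \<and>
     (\<forall>\<beta>\<in>Field \<mu>. \<forall>b\<in>tuples \<mu> \<beta> (univ M). underS \<mu> \<beta> \<noteq> {} \<longrightarrow>
        b ` underS \<mu> \<beta> \<subseteq> hull M \<beta> b \<and>
        le (sub_hull M \<beta> b) (reduct L M) \<and>
        (\<forall>\<gamma>\<in>underS \<mu> \<beta>. underS \<mu> \<gamma> \<noteq> {} \<longrightarrow>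
          (\<forall>\<sigma>\<in>tuples \<mu> \<gamma> (underS \<mu> \<beta>). hull M \<gamma> (tcomp \<gamma> b \<sigma>) \<subseteq> hull M \<beta> b)))"

lemma goodD:
  assumes "good M" "\<beta> \<in> Field \<mu>" "underS \<mu> \<beta> \<noteq> {}" "b \<in> tuples \<mu> \<beta> (univ M)"
  shows "b ` underS \<mu> \<beta> \<subseteq> hull M \<beta> b"
    and "le (sub_hull M \<beta> b) (reduct L M)"
    and "\<gamma> \<in> underS \<mu> \<beta> \<Longrightarrow> underS \<mu> \<gamma> \<noteq> {} \<Longrightarrow> \<sigma> \<in> tuples \<mu> \<gamma> (underS \<mu> \<beta>) \<Longrightarrow>
      hull M \<gamma> (tcomp \<gamma> b \<sigma>) \<subseteq> hull M \<beta> b"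
  using assms unfolding good_def by blast+

definition app :: "'c \<Rightarrow> ('m \<Rightarrow> 'm) \<Rightarrow> ('f + 'c, 'm) trm" where
  "app c \<sigma> = Fn (Inr c) (\<lambda>i\<in>underS \<mu> (ar c). Var (\<sigma> i))"

text \<open>Variables name the entries of a tuple of length \<open>\<beta>\<close>, single
  applications name the hulls of its subtuples. Depth one suffices because hulls in good structures
  are closed under the functions of \<open>L\<close>.\<close>

definition trms :: "'m \<Rightarrow> ('f + 'c, 'm) trm set" where
  "trms \<beta> = Var ` underS \<mu> \<beta> \<union>
     {app c \<sigma> | c \<sigma>. c \<in> Field \<chi> \<and> \<sigma> \<in> tuples \<mu> (ar c) (underS \<mu> \<beta>)}"

text \<open>This sentence separates the structure with empty universe, which has no nonempty tuples.\<close>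

definition nonempty_fm :: "('f + 'c, 'r + 'c, 'm) fm" where
  "nonempty_fm = (let x = SOME x. x \<in> Field \<mu> in Exs {x} (Eq (Var x) (Var x)))"

text \<open>The truth values of these formulas fix the equalities, the graphs of the functions of
  \<open>L\<close> and the relations of \<open>L\<close> on the named elements, hence the
  isomorphism type of a hull closed under the functions.\<close>

definition fms :: "'m \<Rightarrow> ('f + 'c, 'r + 'c, 'm) fm set" where
  "fms \<beta> =
     {Eq s t | s t. s \<in> trms \<beta> \<and> t \<in> trms \<beta>} \<union>
     {Eq (Fn (Inl f) ts) t | f ts t.
        f \<in> funs L \<and> ts \<in> tuples \<mu> (farity L f) (trms \<beta>) \<and> t \<in> trms \<beta>} \<union>
     {Rl (Inl r) ts | r ts. r \<in> rels L \<and> ts \<in> tuples \<mu> (rarity L r) (trms \<beta>)} \<union>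
     {nonempty_fm}"

text \<open>The good structures may form a proper class, but the types consist of formulas from a
  set of size at most \<chi>, which bounds their number by \<open>ctwo ^c \<chi>\<close>.\<close>

definition \<Gamma> :: "('m set \<times> ('f + 'c, 'r + 'c, 'm) fm set) set" where
  "\<Gamma> = {(underS \<mu> \<beta>, p) | \<beta> p. \<beta> \<in> Field \<mu> \<and> p \<subseteq> fms \<beta> \<union> Neg ` fms \<beta> \<and>
     (\<forall>M. good M \<longrightarrow> omits \<mu> L\<^sub>1 M (underS \<mu> \<beta>, p))}"

text \<open>
  All the information is in the types; the theory consists of \<open>\<chi>\<close> valid sentences, just to have the
  required size.
\<close>

definition refl_fm :: "'c \<Rightarrow> ('f + 'c, 'r + 'c, 'm) fm" where
  "refl_fm c = Neg (Exs (underS \<mu> (ar c)) (Neg (Eq (app c id) (app c id))))"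

definition T\<^sub>1 :: "('f + 'c, 'r + 'c, 'm) fm set" where
  "T\<^sub>1 = refl_fm ` Field \<chi>"

section \<open>Well-formedness of the language, the theory and the types\<close>

lemma L\<^sub>1_simps [simp]:
  "Inl f \<in> funs L\<^sub>1 \<longleftrightarrow> f \<in> funs L"
  "Inr c \<in> funs L\<^sub>1 \<longleftrightarrow> c \<in> Field \<chi>"
  "Inl r \<in> rels L\<^sub>1 \<longleftrightarrow> r \<in> rels L"
  "Inr c \<notin> rels L\<^sub>1"
  "farity L\<^sub>1 (Inl f) = farity L f"
  "farity L\<^sub>1 (Inr c) = ar c"
  "rarity L\<^sub>1 (Inl r) = rarity L r"
  by (auto simp: L\<^sub>1_def)

lemma mu_Card_order: "Card_order \<mu>"
  using mu by simp

lemma infinite_mu: "\<not> finite (Field \<mu>)"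
  using mu by (simp add: cinfinite_def)

lemma lang_L: "mu_ary_lang \<mu> L"
  using abs_class by (simp add: mu_abstract_class_def)

lemma K_struc: "M \<in> K \<Longrightarrow> is_struc \<mu> L \<U> M"
  using abs_class by (simp add: mu_abstract_class_def)

lemma le_K: "le M N \<Longrightarrow> M \<in> K" "le M N \<Longrightarrow> N \<in> K"
  and le_substruc: "le M N \<Longrightarrow> substruc \<mu> L M N"
  using abs_class by (auto simp: mu_abstract_class_def)

lemma le_refl: "M \<in> K \<Longrightarrow> le M M"
  and le_trans: "le M N \<Longrightarrow> le N P \<Longrightarrow> le M P"
  using abs_class unfolding mu_abstract_class_def by blast+

lemma le_eq_restr: "le N M \<Longrightarrow> N = restr \<mu> L M (univ N)"
  using substruc_eq_restr le_K le_substruc K_struc by blast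

lemma le_restr_restr:
  assumes "le (restr \<mu> L M A) M" "le (restr \<mu> L M B) M" "A \<subseteq> B"
  shows "le (restr \<mu> L M A) (restr \<mu> L M B)"
  using coh assms le_K substruc_restr_restr[OF assms(3)] unfolding coherence_def by blast

lemma mu_ary_lang_L\<^sub>1: "mu_ary_lang \<mu> L\<^sub>1"
  using lang_L ar by (auto simp: mu_ary_lang_def L\<^sub>1_def)

lemma sublang_L\<^sub>1: "sublang L L\<^sub>1"
  by (simp add: sublang_def)

lemma underS_Field: "underS \<mu> \<beta> \<subseteq> Field \<mu>"
  by (auto simp: underS_def Field_def)

lemma trms_is_trm:
  assumes "t \<in> trms \<beta>"
  shows "is_trm \<mu> L\<^sub>1 t" "trm_vars \<mu> L\<^sub>1 t \<subseteq> underS \<mu> \<beta>"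
  using assms underS_Field[of \<beta>] by (auto simp: trms_def app_def tuples_def PiE_iff subset_eq)

lemma nonempty_fm:
  "is_fm \<mu> L\<^sub>1 nonempty_fm" "free_vars \<mu> L\<^sub>1 nonempty_fm = {}"
  "sat \<mu> L\<^sub>1 M nonempty_fm v \<longleftrightarrow> univ M \<noteq> {}"
proof -
  have "Field \<mu> \<noteq> {}"
    using infinite_mu by auto
  then have "(SOME x. x \<in> Field \<mu>) \<in> Field \<mu>"
    by (simp add: some_in_eq)
  moreover have "|{SOME x. x \<in> Field \<mu>}| <o \<mu>"
    using card_singleton_less[OF mu(1)] .
  ultimately show "is_fm \<mu> L\<^sub>1 nonempty_fm"
    by (simp add: nonempty_fm_def Let_def)
  show "free_vars \<mu> L\<^sub>1 nonempty_fm = {}"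
    by (simp add: nonempty_fm_def Let_def)
  show "sat \<mu> L\<^sub>1 M nonempty_fm v \<longleftrightarrow> univ M \<noteq> {}"
    by (auto simp: nonempty_fm_def Let_def)
qed

lemma fmsE:
  assumes "\<phi> \<in> fms \<beta>"
  obtains (eq) s t where "\<phi> = Eq s t" "s \<in> trms \<beta>" "t \<in> trms \<beta>"
    | (fn) f ts t where "\<phi> = Eq (Fn (Inl f) ts) t" "f \<in> funs L"
        "ts \<in> tuples \<mu> (farity L f) (trms \<beta>)" "t \<in> trms \<beta>"
    | (rl) r ts where "\<phi> = Rl (Inl r) ts" "r \<in> rels L" "ts \<in> tuples \<mu> (rarity L r) (trms \<beta>)"
    | (ne) "\<phi> = nonempty_fm"
  using assms unfolding fms_def by blast

lemma fms_is_fm: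
  assumes "\<phi> \<in> fms \<beta>"
  shows "is_fm \<mu> L\<^sub>1 \<phi>" "free_vars \<mu> L\<^sub>1 \<phi> \<subseteq> underS \<mu> \<beta>"
proof -
  have ts: "ts \<in> extensional (underS \<mu> \<gamma>)"
      "\<forall>i\<in>underS \<mu> \<gamma>. is_trm \<mu> L\<^sub>1 (ts i) \<and> trm_vars \<mu> L\<^sub>1 (ts i) \<subseteq> underS \<mu> \<beta>"
    if "ts \<in> tuples \<mu> \<gamma> (trms \<beta>)" for ts \<gamma>
    using that trms_is_trm[of _ \<beta>] by (auto simp: tuples_def PiE_iff)
  have "is_fm \<mu> L\<^sub>1 \<phi> \<and> free_vars \<mu> L\<^sub>1 \<phi> \<subseteq> underS \<mu> \<beta>"
    using assms
  proof (cases rule: fmsE)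
    case eq
    then show ?thesis
      using trms_is_trm[of _ \<beta>] by simp
  next
    case fn
    then show ?thesis
      using trms_is_trm[of _ \<beta>] ts[OF fn(3)] by (simp add: UN_subset_iff)
  next
    case rl
    then show ?thesis
      using ts[OF rl(3)] by (simp add: UN_subset_iff)
  next
    case ne
    then show ?thesis
      by (simp add: nonempty_fm)
  qed
  then show "is_fm \<mu> L\<^sub>1 \<phi>" "free_vars \<mu> L\<^sub>1 \<phi> \<subseteq> underS \<mu> \<beta>"
    by simp_all
qed

lemma \<Gamma>_is_type:
  assumes "p \<in> \<Gamma>"
  shows "is_type \<mu> L\<^sub>1 p"
proof -
  obtain \<beta> q where p: "p = (underS \<mu> \<beta>, q)" and \<beta>: "\<beta> \<in> Field \<mu>" and q: "q \<subseteq> fms \<beta> \<union> Neg ` fms \<beta>"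
    using assms unfolding \<Gamma>_def by blast
  have "is_fm \<mu> L\<^sub>1 \<phi> \<and> free_vars \<mu> L\<^sub>1 \<phi> \<subseteq> underS \<mu> \<beta>" if "\<phi> \<in> q" for \<phi>
    using subsetD[OF q that] by (elim UnE imageE) (simp_all add: fms_is_fm)
  then show ?thesis
    using underS_Field card_of_underS[OF mu_Card_order \<beta>] by (simp add: p is_type_def)
qed

lemma T\<^sub>1_is_theory: "is_theory \<mu> L\<^sub>1 T\<^sub>1"
proof -
  have "is_fm \<mu> L\<^sub>1 (refl_fm c) \<and> free_vars \<mu> L\<^sub>1 (refl_fm c) = {}" if "c \<in> Field \<chi>" for c
    using that underS_Field[of "ar c"] card_of_underS[OF mu_Card_order ar(1)[OF that]]
    by (auto simp: refl_fm_def app_def)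
  then show ?thesis
    by (auto simp: is_theory_def T\<^sub>1_def)
qed

lemma T\<^sub>1_models: "models \<mu> L\<^sub>1 M T\<^sub>1"
  by (auto simp: models_def T\<^sub>1_def refl_fm_def)

section \<open>Cardinality of the theory and of the set of types\<close>

lemma chi_Card_order: "Card_order \<chi>"
  using lst by (simp add: lst_cardinal_def)

text \<open>The symbol \<open>c\<close> can be read off from \<open>refl_fm c\<close>, so the
  sentences are pairwise distinct.\<close>

lemma card_T\<^sub>1: "|T\<^sub>1| =o \<chi>"
proof -
  have "bij_betw refl_fm (Field \<chi>) T\<^sub>1"
    by (auto simp: bij_betw_def T\<^sub>1_def refl_fm_def app_def inj_on_def)
  then have "|Field \<chi>| =o |T\<^sub>1|"
    using iffD1[OF card_of_ordIso] by blast
  then show ?thesis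
    by (rule ordIso_transitive[OF ordIso_symmetric card_of_Field_ordIso[OF chi_Card_order]])
qed

lemma mu_le_chi: "\<mu> \<le>o \<chi>"
  and lang_le_chi: "|funs L| \<le>o \<chi>" "|rels L| \<le>o \<chi>"
proof -
  have *: "|funs L <+> rels L| +c \<mu> \<le>o \<chi>"
    using lst by (simp add: lst_cardinal_def)
  show "\<mu> \<le>o \<chi>"
    using ordLeq_transitive[OF ordLeq_csum2[OF mu_Card_order] *] .
  have "|funs L <+> rels L| \<le>o \<chi>"
    using ordLeq_transitive[OF ordLeq_csum1[OF card_of_Card_order] *] .
  then show "|funs L| \<le>o \<chi>" "|rels L| \<le>o \<chi>"
    by (rule ordLeq_transitive[OF card_of_Plus1], rule ordLeq_transitive[OF card_of_Plus2])
qed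

lemma chi_Cinfinite: "Cinfinite \<chi>"
  using cinfinite_mono[OF mu_le_chi] mu(1) chi_Card_order by simp

lemma Field_mu_le: "|Field \<mu>| \<le>o \<chi>"
  using ordIso_ordLeq_trans[OF card_of_Field_ordIso[OF mu_Card_order] mu_le_chi] .

lemma Field_chi_le: "|Field \<chi>| \<le>o \<chi>"
  using ordIso_imp_ordLeq[OF card_of_Field_ordIso[OF chi_Card_order]] .

text \<open>This is the equation \<open>\<chi> = \<chi>^{<\<mu>}\<close> combined with monotonicity.
  It absorbs the argument lists of terms and formulas, and later the index set in the choice of
  submodels.\<close>

lemma short_tuples_le:
  assumes "|A| \<le>o \<chi>"
  shows "|short_tuples \<mu> A| \<le>o \<chi>"
proof -
  have "|A| \<le>o |Field \<chi>|"
    using ordLeq_ordIso_trans[OF assms ordIso_symmetric[OF card_of_Field_ordIso[OF chi_Card_order]]] .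
  from short_tuples_mono[OF this] show ?thesis
    by (rule ordLeq_ordIso_trans) (use lst in \<open>simp add: lst_cardinal_def\<close>)
qed

lemma Times_le: "|A| \<le>o \<chi> \<Longrightarrow> |B| \<le>o \<chi> \<Longrightarrow> |A \<times> B| \<le>o \<chi>"
  using chi_Cinfinite by (auto intro: card_of_Times_ordLeq_infinite_Field simp: cinfinite_def)

lemma Un_le: "|A| \<le>o \<chi> \<Longrightarrow> |B| \<le>o \<chi> \<Longrightarrow> |A \<union> B| \<le>o \<chi>"
  using chi_Cinfinite Un_Cinfinite_bound by blast

lemma card_subset_le: "A \<subseteq> B \<Longrightarrow> |B| \<le>o \<chi> \<Longrightarrow> |A| \<le>o \<chi>"
  by (rule ordLeq_transitive[OF card_of_mono1])

lemma image_le: "|A| \<le>o \<chi> \<Longrightarrow> |f ` A| \<le>o \<chi>"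
  by (rule ordLeq_transitive[OF card_of_image])

lemma tuples_short: "\<gamma> \<in> Field \<mu> \<Longrightarrow> t \<in> tuples \<mu> \<gamma> A \<Longrightarrow> A \<subseteq> B \<Longrightarrow> (\<gamma>, t) \<in> short_tuples \<mu> B"
  using tuples_mono by (fastforce simp: short_tuples_def)

lemma card_trms: "|\<Union>\<beta>\<in>Field \<mu>. trms \<beta>| \<le>o \<chi>"
proof -
  have "(\<Union>\<beta>\<in>Field \<mu>. trms \<beta>) \<subseteq>
    Var ` Field \<mu> \<union> (\<lambda>(c, \<gamma>, \<sigma>). app c \<sigma>) ` (Field \<chi> \<times> short_tuples \<mu> (Field \<mu>))"
  proof (intro UN_least subsetI)
    fix \<beta> t assume "t \<in> trms \<beta>"
    then consider x where "t = Var x" "x \<in> underS \<mu> \<beta>"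
      | c \<sigma> where "t = app c \<sigma>" "c \<in> Field \<chi>" "\<sigma> \<in> tuples \<mu> (ar c) (underS \<mu> \<beta>)"
      unfolding trms_def by blast
    then show "t \<in> Var ` Field \<mu> \<union> (\<lambda>(c, \<gamma>, \<sigma>). app c \<sigma>) ` (Field \<chi> \<times> short_tuples \<mu> (Field \<mu>))"
    proof cases
      case 1
      then show ?thesis using underS_Field by auto
    next
      case 2
      then have "(ar c, \<sigma>) \<in> short_tuples \<mu> (Field \<mu>)"
        using tuples_short[OF ar(1) _ underS_Field] by blast
      then have "t \<in> (\<lambda>(c, \<gamma>, \<sigma>). app c \<sigma>) ` (Field \<chi> \<times> short_tuples \<mu> (Field \<mu>))"
        using 2 by (intro image_eqI[of _ _ "(c, ar c, \<sigma>)"]) auto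
      then show ?thesis ..
    qed
  qed
  then show ?thesis
    by (rule card_subset_le)
      (intro Un_le image_le Times_le short_tuples_le Field_mu_le Field_chi_le)
qed

lemma card_fms: "|\<Union>\<beta>\<in>Field \<mu>. fms \<beta>| \<le>o \<chi>"
proof -
  define TT where "TT = (\<Union>\<beta>\<in>Field \<mu>. trms \<beta>)"
  have TT: "trms \<beta> \<subseteq> TT" if "\<beta> \<in> Field \<mu>" for \<beta>
    using that by (auto simp: TT_def)
  have card_TT: "|TT| \<le>o \<chi>"
    using card_trms by (simp add: TT_def)
  have one: "|{nonempty_fm}| \<le>o \<chi>"
    using ordLess_imp_ordLeq[OF card_singleton_less[OF chi_Cinfinite]] .
  have "(\<Union>\<beta>\<in>Field \<mu>. fms \<beta>) \<subseteq>
    (\<lambda>(s, t). Eq s t) ` (TT \<times> TT) \<union>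
    (\<lambda>(f, (\<gamma>, ts), t). Eq (Fn (Inl f) ts) t) ` (funs L \<times> short_tuples \<mu> TT \<times> TT) \<union>
    (\<lambda>(r, \<gamma>, ts). Rl (Inl r) ts) ` (rels L \<times> short_tuples \<mu> TT) \<union> {nonempty_fm}"
  proof (intro UN_least subsetI)
    fix \<beta> \<phi> assume \<beta>: "\<beta> \<in> Field \<mu>" and \<phi>: "\<phi> \<in> fms \<beta>"
    have f: "(farity L f, ts) \<in> short_tuples \<mu> TT"
      if "f \<in> funs L" "ts \<in> tuples \<mu> (farity L f) (trms \<beta>)" for f ts
      using that lang_L TT[OF \<beta>] by (auto intro: tuples_short simp: mu_ary_lang_def)
    have r: "(rarity L r, ts) \<in> short_tuples \<mu> TT"
      if "r \<in> rels L" "ts \<in> tuples \<mu> (rarity L r) (trms \<beta>)" for r ts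
      using that lang_L TT[OF \<beta>] by (auto intro: tuples_short simp: mu_ary_lang_def)
    show "\<phi> \<in> (\<lambda>(s, t). Eq s t) ` (TT \<times> TT) \<union>
      (\<lambda>(f, (\<gamma>, ts), t). Eq (Fn (Inl f) ts) t) ` (funs L \<times> short_tuples \<mu> TT \<times> TT) \<union>
      (\<lambda>(r, \<gamma>, ts). Rl (Inl r) ts) ` (rels L \<times> short_tuples \<mu> TT) \<union> {nonempty_fm}"
      using \<phi>
    proof (cases rule: fmsE)
      case (eq s t)
      then have "\<phi> \<in> (\<lambda>(s, t). Eq s t) ` (TT \<times> TT)"
        using TT[OF \<beta>] by (intro image_eqI[of _ _ "(s, t)"]) auto
      then show ?thesis by simp
    next
      case (fn f ts t)
      then have "\<phi> \<in> (\<lambda>(f, (\<gamma>, ts), t). Eq (Fn (Inl f) ts) t) ` (funs L \<times> short_tuples \<mu> TT \<times> TT)"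
        using TT[OF \<beta>] f[OF fn(2,3)] by (intro image_eqI[of _ _ "(f, (farity L f, ts), t)"]) auto
      then show ?thesis by simp
    next
      case (rl r ts)
      then have "\<phi> \<in> (\<lambda>(r, \<gamma>, ts). Rl (Inl r) ts) ` (rels L \<times> short_tuples \<mu> TT)"
        using r[OF rl(2,3)] by (intro image_eqI[of _ _ "(r, rarity L r, ts)"]) auto
      then show ?thesis by simp
    next
      case ne
      then show ?thesis by simp
    qed
  qed
  then show ?thesis
    by (rule card_subset_le)
      (intro Un_le image_le Times_le short_tuples_le card_TT lang_le_chi one)
qed

lemma card_\<Gamma>: "|\<Gamma>| \<le>o ctwo ^c \<chi>"
proof -
  define A where "A = (\<Union>\<beta>\<in>Field \<mu>. fms \<beta>)"
  \<comment> \<open>A type is coded by one subset of a disjoint sum: the left part gives its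
    variables, the right part its formulas.\<close>
  have "\<Gamma> \<subseteq> (\<lambda>P. (Inl -` P, Inr -` P)) ` Pow (Field \<mu> <+> (A \<union> Neg ` A))"
  proof
    fix q assume "q \<in> \<Gamma>"
    then obtain \<beta> p where q: "q = (underS \<mu> \<beta>, p)" "\<beta> \<in> Field \<mu>" "p \<subseteq> fms \<beta> \<union> Neg ` fms \<beta>"
      by (auto simp: \<Gamma>_def)
    then have "p \<subseteq> A \<union> Neg ` A"
      by (auto simp: A_def)
    then show "q \<in> (\<lambda>P. (Inl -` P, Inr -` P)) ` Pow (Field \<mu> <+> (A \<union> Neg ` A))"
      using underS_Field[of \<beta>] by (intro image_eqI[of _ _ "underS \<mu> \<beta> <+> p"]) (auto simp: q(1))
  qed
  then have 1: "|\<Gamma>| \<le>o |Pow (Field \<mu> <+> (A \<union> Neg ` A))|"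
    by (rule ordLeq_transitive[OF card_of_mono1 card_of_image])
  have "|A \<union> Neg ` A| \<le>o \<chi>"
    using card_fms unfolding A_def[symmetric] by (intro Un_le image_le)
  then have "|Field \<mu> <+> (A \<union> Neg ` A)| \<le>o \<chi>"
    using Field_mu_le chi_Cinfinite
    by (intro card_of_Plus_ordLeq_infinite_Field) (auto simp: cinfinite_def)
  then have "|Field \<mu> <+> (A \<union> Neg ` A)| \<le>o |Field \<chi>|"
    by (rule ordLeq_ordIso_trans[OF _ ordIso_symmetric[OF card_of_Field_ordIso[OF chi_Card_order]]])
  then have 2: "|Pow (Field \<mu> <+> (A \<union> Neg ` A))| \<le>o |Pow (Field \<chi>)|"
    by (rule card_Pow_mono)
  have "|Pow (Field \<chi>)| \<le>o ctwo ^c \<chi>"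
    unfolding cexp_def ctwo_def Field_card_of
    by (rule ordIso_imp_ordLeq[OF card_of_Pow_Func])
  then show ?thesis
    using ordLeq_transitive[OF 1 ordLeq_transitive[OF 2]] by blast
qed


section \<open>Good expansions of the members of the class\<close>

lemma tcomp_tuples:
  "\<sigma> \<in> tuples \<mu> \<gamma> (underS \<mu> \<beta>) \<Longrightarrow> b \<in> tuples \<mu> \<beta> A \<Longrightarrow> tcomp \<gamma> b \<sigma> \<in> tuples \<mu> \<gamma> A"
  by (auto simp: tuples_def compose_def PiE_iff)

lemma tcomp_id: "b \<in> tuples \<mu> \<beta> A \<Longrightarrow> tcomp \<beta> b (restrict id (underS \<mu> \<beta>)) = b"
  by (auto simp: tuples_def compose_def PiE_iff extensional_def fun_eq_iff)

text \<open>For sets of size at most \<chi> the bound \<open>|A|^{<\<mu>} + \<chi>\<close> collapses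
  to \<chi>.\<close>

lemma LST:
  assumes "M \<in> K" "A \<subseteq> univ M" "|A| \<le>o \<chi>"
  obtains B where "le (restr \<mu> L M B) M" "A \<subseteq> B" "|B| \<le>o \<chi>"
proof -
  have "\<exists>N. le N M \<and> A \<subseteq> univ N \<and> |univ N| \<le>o |short_tuples \<mu> A| +c \<chi>"
    using lst assms(1,2) by (simp add: lst_cardinal_def)
  then obtain N where N: "le N M" "A \<subseteq> univ N" "|univ N| \<le>o |short_tuples \<mu> A| +c \<chi>"
    by blast
  have "|short_tuples \<mu> A| +c \<chi> \<le>o \<chi>"
    using chi_Cinfinite short_tuples_le[OF assms(3)] ordLeq_refl[OF chi_Card_order]
    by (intro csum_cinfinite_bound) (simp_all add: card_of_Card_order)
  then have "|univ N| \<le>o \<chi>"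
    by (rule ordLeq_transitive[OF N(3)])
  then show ?thesis
    using that[of "univ N"] N(1,2) le_eq_restr[OF N(1)] by simp
qed

text \<open>The sets are chosen by recursion on the length of the tuple. At each stage the entries
  and all sets chosen for strictly shorter subtuples have a union of size at most \<chi>, and some
  strong submodel of size at most \<chi> contains it.\<close>

lemma ex_submodels:
  assumes M: "M \<in> K"
  shows "\<exists>W. \<forall>\<beta>\<in>Field \<mu>. \<forall>b\<in>tuples \<mu> \<beta> (univ M).
    le (restr \<mu> L M (W \<beta> b)) M \<and> b ` underS \<mu> \<beta> \<subseteq> W \<beta> b \<and> |W \<beta> b| \<le>o \<chi> \<and>
    (\<forall>\<gamma>\<in>underS \<mu> \<beta>. \<forall>\<sigma>\<in>tuples \<mu> \<gamma> (underS \<mu> \<beta>). W \<gamma> (tcomp \<gamma> b \<sigma>) \<subseteq> W \<beta> b)"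
proof -
  define Q where "Q f \<beta> b B \<longleftrightarrow> le (restr \<mu> L M B) M \<and> b ` underS \<mu> \<beta> \<subseteq> B \<and> |B| \<le>o \<chi> \<and>
      (\<forall>\<gamma>\<in>underS \<mu> \<beta>. \<forall>\<sigma>\<in>tuples \<mu> \<gamma> (underS \<mu> \<beta>). f \<gamma> (tcomp \<gamma> b \<sigma>) \<subseteq> B)"
    for f :: "'m \<Rightarrow> ('m \<Rightarrow> 'a) \<Rightarrow> 'a set" and \<beta> b B
  \<comment> \<open>All tuples of one length are treated together: the recursion runs over
    \<open>\<beta>\<close> alone and its value at \<open>\<beta>\<close> is a function of
    \<open>b\<close>.\<close>
  define P where "P f \<beta> g \<longleftrightarrow> (\<beta> \<in> Field \<mu> \<longrightarrow> (\<forall>b\<in>tuples \<mu> \<beta> (univ M). Q f \<beta> b (g b)))"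
    for f :: "'m \<Rightarrow> ('m \<Rightarrow> 'a) \<Rightarrow> 'a set" and \<beta> g
  have R: "(\<gamma>, \<beta>) \<in> \<mu> - Id \<longleftrightarrow> \<gamma> \<in> underS \<mu> \<beta>" for \<gamma> \<beta>
    by (auto simp: underS_def)
  have "wf (\<mu> - Id)"
    using mu_Card_order by (simp add: card_order_on_def well_order_on_def)
  then have "\<exists>f. \<forall>\<beta>. P f \<beta> (f \<beta>)"
  proof (rule dependent_wf_choice)
    \<comment> \<open>The recursion is legitimate because the condition at \<open>\<beta>\<close>
      consults the assignment only below \<open>\<beta>\<close>.\<close>
    fix f g :: "'m \<Rightarrow> ('m \<Rightarrow> 'a) \<Rightarrow> 'a set" and \<beta> r
    assume fg: "\<And>\<gamma>. (\<gamma>, \<beta>) \<in> \<mu> - Id \<Longrightarrow> f \<gamma> = g \<gamma>"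
    have "f \<gamma> = g \<gamma>" if "\<gamma> \<in> underS \<mu> \<beta>" for \<gamma>
      using fg[OF iffD2[OF R that]] .
    then show "P f \<beta> r = P g \<beta> r"
      by (simp add: P_def Q_def cong: ball_cong)
  next
    fix \<beta> and f :: "'m \<Rightarrow> ('m \<Rightarrow> 'a) \<Rightarrow> 'a set"
    assume IH: "\<And>\<gamma>. (\<gamma>, \<beta>) \<in> \<mu> - Id \<Longrightarrow> P f \<gamma> (f \<gamma>)"
    have f: "Q f \<gamma> b (f \<gamma> b)" if "\<gamma> \<in> underS \<mu> \<beta>" "b \<in> tuples \<mu> \<gamma> (univ M)" for \<gamma> b
      using IH[OF iffD2[OF R that(1)]] that(2) subsetD[OF underS_Field that(1)] by (simp add: P_def)
    have "\<exists>B. Q f \<beta> b B" if \<beta>: "\<beta> \<in> Field \<mu>" and b: "b \<in> tuples \<mu> \<beta> (univ M)" for b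
    proof -
      \<comment> \<open>The index set does not depend on \<open>b\<close> and consists of short
        tuples over \<open>Field \<mu>\<close>, so it has size at most \<chi>.\<close>
      define I where "I = (SIGMA \<gamma>:underS \<mu> \<beta>. tuples \<mu> \<gamma> (underS \<mu> \<beta>))"
      define A where "A = b ` underS \<mu> \<beta> \<union> (\<Union>(\<gamma>, \<sigma>)\<in>I. f \<gamma> (tcomp \<gamma> b \<sigma>))"
      have fI: "Q f \<gamma> (tcomp \<gamma> b \<sigma>) (f \<gamma> (tcomp \<gamma> b \<sigma>))" if "(\<gamma>, \<sigma>) \<in> I" for \<gamma> \<sigma>
        using that f[OF _ tcomp_tuples[OF _ b]] by (simp add: I_def)
      have "I \<subseteq> short_tuples \<mu> (Field \<mu>)"
        using subsetD[OF underS_Field] tuples_short[OF _ _ underS_Field] by (auto simp: I_def)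
      then have "|I| \<le>o \<chi>"
        by (rule card_subset_le) (rule short_tuples_le[OF Field_mu_le])
      moreover have "\<forall>i\<in>I. |case i of (\<gamma>, \<sigma>) \<Rightarrow> f \<gamma> (tcomp \<gamma> b \<sigma>)| \<le>o \<chi>"
        using fI by (auto simp: Q_def)
      ultimately have "|\<Union>(\<gamma>, \<sigma>)\<in>I. f \<gamma> (tcomp \<gamma> b \<sigma>)| \<le>o \<chi>"
        by (rule UNION_Cinfinite_bound[OF _ _ chi_Cinfinite])
      then have card_A: "|A| \<le>o \<chi>"
        unfolding A_def by (intro Un_le image_le card_subset_le[OF underS_Field Field_mu_le])
      have "f \<gamma> (tcomp \<gamma> b \<sigma>) \<subseteq> univ M" if "(\<gamma>, \<sigma>) \<in> I" for \<gamma> \<sigma>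
        using fI[OF that] le_substruc by (force simp: Q_def substruc_def)
      then have "A \<subseteq> univ M"
        using b by (fastforce simp: A_def tuples_def)
      then obtain B where "le (restr \<mu> L M B) M" "A \<subseteq> B" "|B| \<le>o \<chi>"
        using LST[OF M _ card_A] by blast
      then have "Q f \<beta> b B"
        unfolding Q_def A_def I_def by fast
      then show ?thesis ..
    qed
    then show "\<exists>g. P f \<beta> g"
      unfolding P_def by metis
  qed
  then obtain W where W: "\<And>\<beta>. P W \<beta> (W \<beta>)"
    by blast
  then show ?thesis
    unfolding P_def Q_def by blast
qed

text \<open>The new symbols of arity \<open>\<beta>\<close> are interpreted so that their values at
  \<open>b\<close> enumerate \<open>W \<beta> b\<close>. A surjection exists because the fibre of
  \<open>ar\<close> has at least \<chi> elements and \<open>W \<beta> b\<close> contains the entries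
  of the nonempty tuple \<open>b\<close>.\<close>

lemma ex_good_expansion:
  assumes M: "M \<in> K"
  obtains M\<^sub>1 where "good M\<^sub>1" "reduct L M\<^sub>1 = M"
proof -
  obtain W where "\<forall>\<beta>\<in>Field \<mu>. \<forall>b\<in>tuples \<mu> \<beta> (univ M).
    le (restr \<mu> L M (W \<beta> b)) M \<and> b ` underS \<mu> \<beta> \<subseteq> W \<beta> b \<and> |W \<beta> b| \<le>o \<chi> \<and>
    (\<forall>\<gamma>\<in>underS \<mu> \<beta>. \<forall>\<sigma>\<in>tuples \<mu> \<gamma> (underS \<mu> \<beta>). W \<gamma> (tcomp \<gamma> b \<sigma>) \<subseteq> W \<beta> b)"
    using ex_submodels[OF M] ..
  then have W:
    "\<And>\<beta> b. \<beta> \<in> Field \<mu> \<Longrightarrow> b \<in> tuples \<mu> \<beta> (univ M) \<Longrightarrow> le (restr \<mu> L M (W \<beta> b)) M"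
    "\<And>\<beta> b. \<beta> \<in> Field \<mu> \<Longrightarrow> b \<in> tuples \<mu> \<beta> (univ M) \<Longrightarrow> b ` underS \<mu> \<beta> \<subseteq> W \<beta> b"
    "\<And>\<beta> b. \<beta> \<in> Field \<mu> \<Longrightarrow> b \<in> tuples \<mu> \<beta> (univ M) \<Longrightarrow> |W \<beta> b| \<le>o \<chi>"
    "\<And>\<beta> b \<gamma> \<sigma>. \<beta> \<in> Field \<mu> \<Longrightarrow> b \<in> tuples \<mu> \<beta> (univ M) \<Longrightarrow> \<gamma> \<in> underS \<mu> \<beta> \<Longrightarrow>
      \<sigma> \<in> tuples \<mu> \<gamma> (underS \<mu> \<beta>) \<Longrightarrow> W \<gamma> (tcomp \<gamma> b \<sigma>) \<subseteq> W \<beta> b"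
    by blast+
  have "\<exists>g. g ` {c \<in> Field \<chi>. ar c = \<beta>} = W \<beta> b"
    if "\<beta> \<in> Field \<mu>" "b \<in> tuples \<mu> \<beta> (univ M)" "underS \<mu> \<beta> \<noteq> {}" for \<beta> b
  proof -
    have "W \<beta> b \<noteq> {}"
      using W(2)[OF that(1,2)] that(3) by blast
    moreover have "|W \<beta> b| \<le>o |{c \<in> Field \<chi>. ar c = \<beta>}|"
      using ordLeq_transitive[OF W(3)[OF that(1,2)] ar_fiber[OF that(1,3)]] .
    ultimately show ?thesis
      by (rule iffD2[OF card_of_ordLeq2])
  qed
  then obtain e where e: "e \<beta> b ` {c \<in> Field \<chi>. ar c = \<beta>} = W \<beta> b"
    if "\<beta> \<in> Field \<mu>" "b \<in> tuples \<mu> \<beta> (univ M)" "underS \<mu> \<beta> \<noteq> {}" for \<beta> b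
    by metis
  define M\<^sub>1 :: "('f + 'c, 'r + 'c, 'm, 'a) struc" where
    "M\<^sub>1 = \<lparr>univ = univ M,
      fun_of = (\<lambda>x\<in>funs L\<^sub>1. case x of Inl f \<Rightarrow> fun_of M f
        | Inr c \<Rightarrow> (\<lambda>b\<in>tuples \<mu> (ar c) (univ M). e (ar c) b c)),
      rel_of = case_sum (rel_of M) (\<lambda>_. {})\<rparr>"
  have [simp]: "univ M\<^sub>1 = univ M"
    by (simp add: M\<^sub>1_def)
  have strM: "is_struc \<mu> L \<U> M"
    using K_struc[OF M] .
  have hull: "hull M\<^sub>1 \<beta> b = W \<beta> b"
    if "\<beta> \<in> Field \<mu>" "b \<in> tuples \<mu> \<beta> (univ M)" "underS \<mu> \<beta> \<noteq> {}" for \<beta> b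
  proof -
    have "hull M\<^sub>1 \<beta> b = e \<beta> b ` {c \<in> Field \<chi>. ar c = \<beta>}"
      using that(2) by (auto simp: hull_def M\<^sub>1_def image_def)
    then show ?thesis
      using e[OF that] by simp
  qed
  have red: "reduct L M\<^sub>1 = M"
  proof (rule struc.equality)
    have "fun_of M \<in> extensional (funs L)"
      using strM by (simp add: is_struc_def PiE_def)
    then show "fun_of (reduct L M\<^sub>1) = fun_of M"
      by (auto simp: reduct_def M\<^sub>1_def fun_eq_iff extensional_def)
    show "rel_of (reduct L M\<^sub>1) = rel_of M"
      using strM by (auto simp: reduct_def M\<^sub>1_def fun_eq_iff is_struc_def)
  qed simp_all
  have "e (ar c) b c \<in> univ M" if "c \<in> Field \<chi>" "b \<in> tuples \<mu> (ar c) (univ M)" for c b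
  proof -
    have "W (ar c) b \<subseteq> univ M"
      using le_substruc[OF W(1)[OF ar(1)[OF that(1)] that(2)]] by (simp add: substruc_def)
    then show ?thesis
      using e[OF ar(1)[OF that(1)] that(2) ar(2)[OF that(1)]] that(1) by blast
  qed
  then have "fun_of M\<^sub>1 (Inr c) \<in> tuples \<mu> (ar c) (univ M) \<rightarrow>\<^sub>E univ M" if "c \<in> Field \<chi>" for c
    using that by (simp add: M\<^sub>1_def)
  moreover have "fun_of M\<^sub>1 (Inl f) \<in> tuples \<mu> (farity L f) (univ M) \<rightarrow>\<^sub>E univ M" if "f \<in> funs L" for f
    using is_struc_fun[OF strM that] that by (simp add: M\<^sub>1_def)
  moreover have "fun_of M\<^sub>1 \<in> extensional (funs L\<^sub>1)"
    by (simp add: M\<^sub>1_def)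
  ultimately have "fun_of M\<^sub>1 \<in> (\<Pi>\<^sub>E x\<in>funs L\<^sub>1. tuples \<mu> (farity L\<^sub>1 x) (univ M) \<rightarrow>\<^sub>E univ M)"
    unfolding PiE_iff by (simp add: split_sum_all Ball_def)
  moreover have "rel_of M\<^sub>1 (Inl r) = rel_of M r" "rel_of M\<^sub>1 (Inr c) = {}" for r c
    by (simp_all add: M\<^sub>1_def)
  then have "\<forall>x\<in>rels L\<^sub>1. rel_of M\<^sub>1 x \<subseteq> tuples \<mu> (rarity L\<^sub>1 x) (univ M)"
    "\<forall>x. x \<notin> rels L\<^sub>1 \<longrightarrow> rel_of M\<^sub>1 x = {}"
    using strM by (auto simp: L\<^sub>1_def is_struc_def split_sum_all)
  ultimately have "is_struc \<mu> L\<^sub>1 \<U> M\<^sub>1"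
    using strM by (simp add: is_struc_def)
  moreover have "hull M\<^sub>1 \<gamma> (tcomp \<gamma> b \<sigma>) \<subseteq> hull M\<^sub>1 \<beta> b"
    if "\<beta> \<in> Field \<mu>" "b \<in> tuples \<mu> \<beta> (univ M)" "underS \<mu> \<beta> \<noteq> {}" "\<gamma> \<in> underS \<mu> \<beta>"
      "underS \<mu> \<gamma> \<noteq> {}" "\<sigma> \<in> tuples \<mu> \<gamma> (underS \<mu> \<beta>)" for \<beta> b \<gamma> \<sigma>
    using hull[OF that(1-3)] hull[OF subsetD[OF underS_Field that(4)] tcomp_tuples[OF that(6,2)] that(5)]
      W(4)[OF that(1,2,4,6)] by simp
  ultimately have "good M\<^sub>1"
    using M W(1,2) hull unfolding good_def by (simp add: red)
  then show ?thesis
    using that red by blast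
qed

lemma K_subset_PC: "K \<subseteq> PC \<mu> L\<^sub>1 \<U> T\<^sub>1 \<Gamma> L"
proof
  fix M assume "M \<in> K"
  then obtain M\<^sub>1 where "good M\<^sub>1" "reduct L M\<^sub>1 = M"
    by (rule ex_good_expansion)
  moreover from \<open>good M\<^sub>1\<close> have "M\<^sub>1 \<in> EC \<mu> L\<^sub>1 \<U> T\<^sub>1 \<Gamma>"
    using T\<^sub>1_models by (auto simp: EC_def \<Gamma>_def good_def)
  ultimately show "M \<in> PC \<mu> L\<^sub>1 \<U> T\<^sub>1 \<Gamma> L"
    unfolding PC_def by blast
qed


section \<open>Reducts of the models omitting the types\<close>

abbreviation val :: "('f + 'c, 'r + 'c, 'm, 'a) struc \<Rightarrow> ('m \<Rightarrow> 'a) \<Rightarrow> ('f + 'c, 'm) trm \<Rightarrow> 'a" where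
  "val M b \<equiv> trm_val \<mu> L\<^sub>1 M b"

text \<open>The equivalence also covers negations, so this is equality of the types of
  \<open>b\<close> and \<open>b'\<close> over \<open>fms \<beta>\<close> and its negations.\<close>

definition same_type where
  "same_type \<beta> M b M' b' \<longleftrightarrow> (\<forall>\<phi>\<in>fms \<beta>. sat \<mu> L\<^sub>1 M \<phi> b \<longleftrightarrow> sat \<mu> L\<^sub>1 M' \<phi> b')"

text \<open>If no good structure realized the type of \<open>b\<close>, this type would belong to
  \<Gamma> and \<open>M\<close> would omit it, although \<open>b\<close> realizes it.\<close>

lemma realized_in_good:
  assumes M: "M \<in> EC \<mu> L\<^sub>1 \<U> T\<^sub>1 \<Gamma>" and \<beta>: "\<beta> \<in> Field \<mu>" and b: "b \<in> tuples \<mu> \<beta> (univ M)"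
  obtains M' b' where "good M'" "b' \<in> tuples \<mu> \<beta> (univ M')" "same_type \<beta> M b M' b'"
proof -
  define p where "p = {\<phi> \<in> fms \<beta> \<union> Neg ` fms \<beta>. sat \<mu> L\<^sub>1 M \<phi> b}"
  have "b ` underS \<mu> \<beta> \<subseteq> univ M"
    using b by (auto simp: tuples_def)
  then have "\<not> omits \<mu> L\<^sub>1 M (underS \<mu> \<beta>, p)"
    by (auto simp: omits_def p_def)
  then have "(underS \<mu> \<beta>, p) \<notin> \<Gamma>"
    using M by (auto simp: EC_def)
  moreover have "p \<subseteq> fms \<beta> \<union> Neg ` fms \<beta>"
    by (auto simp: p_def)
  ultimately obtain M' where M': "good M'" "\<not> omits \<mu> L\<^sub>1 M' (underS \<mu> \<beta>, p)"
    using \<beta> unfolding \<Gamma>_def by blast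
  then obtain v where v: "v ` underS \<mu> \<beta> \<subseteq> univ M'" "\<And>\<phi>. \<phi> \<in> p \<Longrightarrow> sat \<mu> L\<^sub>1 M' \<phi> v"
    by (auto simp: omits_def)
  \<comment> \<open>Cutting \<open>v\<close> down to the length makes it an extensional tuple; the
    formulas have no free variables beyond it.\<close>
  define b' where "b' = restrict v (underS \<mu> \<beta>)"
  have "same_type \<beta> M b M' b'"
    unfolding same_type_def
  proof
    fix \<phi> assume \<phi>: "\<phi> \<in> fms \<beta>"
    have "sat \<mu> L\<^sub>1 M' \<phi> b' \<longleftrightarrow> sat \<mu> L\<^sub>1 M' \<phi> v"
      using fms_is_fm(2)[OF \<phi>] by (intro sat_cong) (auto simp: b'_def)
    moreover have "sat \<mu> L\<^sub>1 M' \<phi> v" if "sat \<mu> L\<^sub>1 M \<phi> b"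
      using v(2)[of \<phi>] \<phi> that by (simp add: p_def)
    moreover have "\<not> sat \<mu> L\<^sub>1 M' \<phi> v" if "\<not> sat \<mu> L\<^sub>1 M \<phi> b"
      using v(2)[of "Neg \<phi>"] \<phi> that by (simp add: p_def)
    ultimately show "sat \<mu> L\<^sub>1 M \<phi> b \<longleftrightarrow> sat \<mu> L\<^sub>1 M' \<phi> b'"
      by blast
  qed
  moreover have "b' \<in> tuples \<mu> \<beta> (univ M')"
    using v(1) by (auto simp: b'_def tuples_def)
  ultimately show ?thesis
    using that M'(1) by blast
qed

lemma same_type_eq:
  assumes "same_type \<beta> M b M' b'" "s \<in> trms \<beta>" "t \<in> trms \<beta>"
  shows "val M b s = val M b t \<longleftrightarrow> val M' b' s = val M' b' t"
proof -
  have "Eq s t \<in> fms \<beta>"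
    using assms(2,3) by (simp add: fms_def)
  with assms(1) have "sat \<mu> L\<^sub>1 M (Eq s t) b \<longleftrightarrow> sat \<mu> L\<^sub>1 M' (Eq s t) b'"
    unfolding same_type_def by blast
  then show ?thesis by simp
qed

lemma same_type_fun:
  assumes "same_type \<beta> M b M' b'" "f \<in> funs L" "ts \<in> tuples \<mu> (farity L f) (trms \<beta>)" "t \<in> trms \<beta>"
  shows "fun_of M (Inl f) (tcomp (farity L f) (val M b) ts) = val M b t \<longleftrightarrow>
    fun_of M' (Inl f) (tcomp (farity L f) (val M' b') ts) = val M' b' t"
proof -
  have "Eq (Fn (Inl f) ts) t \<in> fms \<beta>"
    using assms(2-4) by (simp add: fms_def)
  with assms(1) have "sat \<mu> L\<^sub>1 M (Eq (Fn (Inl f) ts) t) b \<longleftrightarrow> sat \<mu> L\<^sub>1 M' (Eq (Fn (Inl f) ts) t) b'"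
    unfolding same_type_def by blast
  then show ?thesis by (simp add: compose_def)
qed

lemma same_type_rel:
  assumes "same_type \<beta> M b M' b'" "r \<in> rels L" "ts \<in> tuples \<mu> (rarity L r) (trms \<beta>)"
  shows "tcomp (rarity L r) (val M b) ts \<in> rel_of M (Inl r) \<longleftrightarrow>
    tcomp (rarity L r) (val M' b') ts \<in> rel_of M' (Inl r)"
proof -
  have "Rl (Inl r) ts \<in> fms \<beta>"
    using assms(2,3) by (simp add: fms_def)
  with assms(1) have "sat \<mu> L\<^sub>1 M (Rl (Inl r) ts) b \<longleftrightarrow> sat \<mu> L\<^sub>1 M' (Rl (Inl r) ts) b'"
    unfolding same_type_def by blast
  then show ?thesis by (simp add: compose_def)
qed

definition apps :: "'m \<Rightarrow> ('m \<Rightarrow> 'm) \<Rightarrow> ('f + 'c, 'm) trm set" where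
  "apps \<gamma> \<sigma> = {app c \<sigma> | c. c \<in> Field \<chi> \<and> ar c = \<gamma>}"

lemma apps_subset: "\<sigma> \<in> tuples \<mu> \<gamma> (underS \<mu> \<beta>) \<Longrightarrow> apps \<gamma> \<sigma> \<subseteq> trms \<beta>"
  unfolding apps_def trms_def by blast

text \<open>Hulls are the values of a set of terms that is the same for all structures, so facts
  about them can be moved between tuples of the same type.\<close>

lemma hull_tcomp: "hull M \<gamma> (tcomp \<gamma> b \<sigma>) = val M b ` apps \<gamma> \<sigma>"
proof -
  have "val M b (app c \<sigma>) = fun_of M (Inr c) (tcomp (ar c) b \<sigma>)" for c
    by (simp add: app_def compose_def cong: restrict_cong)
  moreover have "apps \<gamma> \<sigma> = (\<lambda>c. app c \<sigma>) ` {c \<in> Field \<chi>. ar c = \<gamma>}"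
    by (auto simp: apps_def)
  moreover have "hull M \<gamma> (tcomp \<gamma> b \<sigma>) =
      (\<lambda>c. fun_of M (Inr c) (tcomp (ar c) b \<sigma>)) ` {c \<in> Field \<chi>. ar c = \<gamma>}"
    by (auto simp: hull_def)
  ultimately show ?thesis
    by (simp add: image_image)
qed

lemma hull_subset:
  assumes "is_struc \<mu> L\<^sub>1 \<U> M" "b \<in> tuples \<mu> \<beta> (univ M)"
  shows "hull M \<beta> b \<subseteq> univ M"
  using is_struc_closed[OF assms(1), of "Inr _"] assms(2) by (auto simp: hull_def)

lemma fun_of_sub_hull:
  "f \<in> funs L \<Longrightarrow> t \<in> tuples \<mu> (farity L f) (hull M \<beta> b) \<Longrightarrow>
    fun_of (sub_hull M \<beta> b) f t = fun_of M (Inl f) t"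
  by (simp add: restr_def reduct_def)

lemma rel_of_sub_hull:
  "r \<in> rels L \<Longrightarrow> t \<in> tuples \<mu> (rarity L r) (hull M \<beta> b) \<Longrightarrow>
    t \<in> rel_of (sub_hull M \<beta> b) r \<longleftrightarrow> t \<in> rel_of M (Inl r)"
  by (simp add: restr_def reduct_def)

text \<open>Choosing a preimage of each entry replaces a tuple of named elements by a tuple of
  terms, to which the formulas in \<open>fms\<close> apply.\<close>

lemma tuple_of_image:
  assumes "t \<in> tuples \<mu> \<alpha> (h ` D)"
  obtains ts where "ts \<in> tuples \<mu> \<alpha> D" "t = tcomp \<alpha> h ts"
proof -
  have "tcomp \<alpha> (inv_into D h) t \<in> tuples \<mu> \<alpha> D"
    using assms by (auto simp: tuples_def compose_def PiE_iff inv_into_into)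
  moreover have "t = tcomp \<alpha> h (tcomp \<alpha> (inv_into D h) t)"
    using assms by (auto simp: tuples_def compose_def PiE_iff extensional_def fun_eq_iff f_inv_into_f)
  ultimately show ?thesis
    using that by blast
qed

text \<open>A good structure \<open>M'\<close> contains a tuple \<open>b'\<close> of the same type
  as \<open>b\<close>. Evaluating the same terms at \<open>b'\<close> and at \<open>b\<close> gives
  an isomorphism between the two hulls, and invariance of \<open>K\<close> and \<open>le\<close>
  under isomorphisms carries the properties over.\<close>

lemma hull_transfer:
  assumes M: "M \<in> EC \<mu> L\<^sub>1 \<U> T\<^sub>1 \<Gamma>" and \<beta>: "\<beta> \<in> Field \<mu>" "underS \<mu> \<beta> \<noteq> {}"
    and b: "b \<in> tuples \<mu> \<beta> (univ M)"
  shows "sub_hull M \<beta> b \<in> K" (is ?A)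
    and "b ` underS \<mu> \<beta> \<subseteq> hull M \<beta> b" (is ?B)
    and "\<And>\<gamma> \<sigma>. \<gamma> \<in> underS \<mu> \<beta> \<Longrightarrow> underS \<mu> \<gamma> \<noteq> {} \<Longrightarrow> \<sigma> \<in> tuples \<mu> \<gamma> (underS \<mu> \<beta>) \<Longrightarrow>
      le (sub_hull M \<gamma> (tcomp \<gamma> b \<sigma>)) (sub_hull M \<beta> b)"
proof -
  obtain M' b' where M': "good M'" and b': "b' \<in> tuples \<mu> \<beta> (univ M')"
    and st: "same_type \<beta> M b M' b'"
    by (rule realized_in_good[OF M \<beta>(1) b])
  have strM: "is_struc \<mu> L\<^sub>1 \<U> M"
    using M by (simp add: EC_def)
  \<comment> \<open>The identity index map presents \<open>b\<close> as a subtuple of itself, so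
    that its own hull is also named by terms.\<close>
  define D where "D = apps \<beta> (restrict id (underS \<mu> \<beta>))"
  have D: "D \<subseteq> trms \<beta>"
    unfolding D_def by (intro apps_subset) (auto simp: tuples_def)
  have hull: "hull M \<beta> b = val M b ` D" and hull': "hull M' \<beta> b' = val M' b' ` D"
    using hull_tcomp[of M \<beta> b "restrict id (underS \<mu> \<beta>)"] tcomp_id[OF b]
      hull_tcomp[of M' \<beta> b' "restrict id (underS \<mu> \<beta>)"] tcomp_id[OF b']
    by (simp_all add: D_def)
  have good_b': "b' ` underS \<mu> \<beta> \<subseteq> val M' b' ` D"
      "le (sub_hull M' \<beta> b') (reduct L M')"
      "\<And>\<gamma> \<sigma>. \<gamma> \<in> underS \<mu> \<beta> \<Longrightarrow> underS \<mu> \<gamma> \<noteq> {} \<Longrightarrow> \<sigma> \<in> tuples \<mu> \<gamma> (underS \<mu> \<beta>) \<Longrightarrow>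
        val M' b' ` apps \<gamma> \<sigma> \<subseteq> val M' b' ` D"
    using goodD[OF M' \<beta> b'] unfolding hull' hull_tcomp by blast+
  \<comment> \<open>A term whose value at \<open>b'\<close> lies in the hull equals some term of
    \<open>D\<close> there; this equation is an atomic formula, so it also holds at
    \<open>b\<close>.\<close>
  have transfer: "\<exists>d\<in>D. val M b t = val M b d \<and> val M' b' t = val M' b' d"
    if t: "t \<in> trms \<beta>" "val M' b' t \<in> val M' b' ` D" for t
    using that D same_type_eq[OF st t(1)] by blast
  show ?B
  proof
    fix y assume "y \<in> b ` underS \<mu> \<beta>"
    then obtain x where x: "x \<in> underS \<mu> \<beta>" "y = b x" by blast
    then have "Var x \<in> trms \<beta>" "val M' b' (Var x) \<in> val M' b' ` D"
      using good_b'(1) by (auto simp: trms_def)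
    from transfer[OF this] show "y \<in> hull M \<beta> b"
      by (auto simp: x(2) hull)
  qed
  define N where "N = sub_hull M \<beta> b"
  define N' where "N' = sub_hull M' \<beta> b'"
  have univ_N: "univ N = val M b ` D" "univ N' = val M' b' ` D"
    by (simp_all add: N_def N'_def hull hull')
  have N'K: "N' \<in> K"
    using le_K(1)[OF good_b'(2)] by (simp add: N'_def)
  \<comment> \<open>The map picks a name in \<open>D\<close> and evaluates it at \<open>b\<close>.
    The choice of the name is immaterial: names with equal values at \<open>b'\<close> have equal
    values at \<open>b\<close>.\<close>
  define g where "g = (\<lambda>y. val M b (inv_into D (val M' b') y))"
  have g: "g (val M' b' t) = val M b t" if t: "t \<in> trms \<beta>" "val M' b' t \<in> val M' b' ` D" for t
  proof -
    have "inv_into D (val M' b') (val M' b' t) \<in> D"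
      using t(2) by (rule inv_into_into)
    moreover have "val M' b' (inv_into D (val M' b') (val M' b' t)) = val M' b' t"
      using t(2) by (rule f_inv_into_f)
    ultimately show ?thesis
      using same_type_eq[OF st subsetD[OF D] t(1)] by (simp add: g_def)
  qed
  have gD: "g (val M' b' t) = val M b t" if "t \<in> D" for t
    using that D by (intro g) auto
  have g_tuple: "tcomp \<alpha> g (tcomp \<alpha> (val M' b') ts) = tcomp \<alpha> (val M b) ts"
    if "ts \<in> tuples \<mu> \<alpha> D" for \<alpha> ts
    using that gD by (auto simp: compose_def tuples_def PiE_iff fun_eq_iff)
  have bij: "bij_betw g (univ N') (univ N)"
  proof (rule bij_betw_imageI)
    show "g ` univ N' = univ N"
      using gD by (simp add: univ_N image_image)
    show "inj_on g (univ N')"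
    proof (rule inj_onI)
      fix y z assume "y \<in> univ N'" "z \<in> univ N'" and eq: "g y = g z"
      then obtain s t where st': "s \<in> D" "t \<in> D" "y = val M' b' s" "z = val M' b' t"
        by (auto simp: univ_N)
      then show "y = z"
        using eq gD same_type_eq[OF st, of s t] subsetD[OF D] by simp
    qed
  qed
  have tcomp_D: "tcomp \<alpha> (val M b) ts \<in> tuples \<mu> \<alpha> (hull M \<beta> b)"
      "tcomp \<alpha> (val M' b') ts \<in> tuples \<mu> \<alpha> (hull M' \<beta> b')"
      "ts \<in> tuples \<mu> \<alpha> (trms \<beta>)"
    if "ts \<in> tuples \<mu> \<alpha> D" for \<alpha> ts
    using that D by (auto simp: hull hull' tuples_def compose_def PiE_iff)
  \<comment> \<open>Closure of the hull in \<open>M\<close> is not known yet. At \<open>b'\<close>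
    the value stays in the hull, as \<open>N'\<close> is a structure; it has a name \<open>d\<close>
    there, and the graph formula transfers to \<open>b\<close>.\<close>
  have funs: "\<exists>d\<in>D. fun_of N f (tcomp (farity L f) (val M b) ts) = val M b d \<and>
      fun_of N' f (tcomp (farity L f) (val M' b') ts) = val M' b' d"
    if f: "f \<in> funs L" and ts: "ts \<in> tuples \<mu> (farity L f) D" for f ts
  proof -
    have "fun_of N' f (tcomp (farity L f) (val M' b') ts) \<in> univ N'"
      using is_struc_closed[OF K_struc[OF N'K] f] tcomp_D(2)[OF ts] by (simp add: N'_def)
    then obtain d where d: "d \<in> D" "fun_of N' f (tcomp (farity L f) (val M' b') ts) = val M' b' d"
      by (auto simp: univ_N)
    then have "fun_of M' (Inl f) (tcomp (farity L f) (val M' b') ts) = val M' b' d"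
      by (simp add: N'_def fun_of_sub_hull[OF f tcomp_D(2)[OF ts]])
    then have "fun_of M (Inl f) (tcomp (farity L f) (val M b) ts) = val M b d"
      using same_type_fun[OF st f tcomp_D(3)[OF ts] subsetD[OF D d(1)]] by simp
    then show ?thesis
      using d by (auto simp: N_def fun_of_sub_hull[OF f tcomp_D(1)[OF ts]])
  qed
  have strN: "is_struc \<mu> L \<U> N"
    unfolding N_def
  proof (rule is_struc_restr)
    show "hull M \<beta> b \<in> \<U>"
      using small_sub[OF _ hull_subset[OF strM b]] strM by (simp add: is_struc_def)
    fix f t assume f: "f \<in> funs L" and t: "t \<in> tuples \<mu> (farity L f) (hull M \<beta> b)"
    obtain ts where ts: "ts \<in> tuples \<mu> (farity L f) D" "t = tcomp (farity L f) (val M b) ts"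
      using t unfolding hull by (rule tuple_of_image)
    have "fun_of (reduct L M) f t = fun_of N f t"
      unfolding N_def fun_of_sub_hull[OF f t] using f by (simp add: reduct_def)
    then show "fun_of (reduct L M) f t \<in> hull M \<beta> b"
      using funs[OF f ts(1)] by (auto simp: ts(2)[symmetric] hull)
  qed
  have iso: "is_iso \<mu> L g N' N"
    unfolding is_iso_def
  proof (intro conjI ballI bij)
    fix f t assume f: "f \<in> funs L" and t: "t \<in> tuples \<mu> (farity L f) (univ N')"
    obtain ts where ts: "ts \<in> tuples \<mu> (farity L f) D" "t = tcomp (farity L f) (val M' b') ts"
      using t unfolding univ_N by (rule tuple_of_image)
    show "g (fun_of N' f t) = fun_of N f (tcomp (farity L f) g t)"
      using funs[OF f ts(1)] gD by (auto simp: ts(2) g_tuple[OF ts(1)])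
  next
    fix r t assume r: "r \<in> rels L" and t: "t \<in> tuples \<mu> (rarity L r) (univ N')"
    obtain ts where ts: "ts \<in> tuples \<mu> (rarity L r) D" "t = tcomp (rarity L r) (val M' b') ts"
      using t unfolding univ_N by (rule tuple_of_image)
    show "t \<in> rel_of N' r \<longleftrightarrow> tcomp (rarity L r) g t \<in> rel_of N r"
      using same_type_rel[OF st r tcomp_D(3)[OF ts(1)]]
      by (simp add: ts(2) g_tuple[OF ts(1)] N_def N'_def
        rel_of_sub_hull[OF r tcomp_D(1)[OF ts(1)]] rel_of_sub_hull[OF r tcomp_D(2)[OF ts(1)]])
  qed
  have NK: "N \<in> K" and image: "le (image_struc \<mu> L g A) N" if "le A N'" for A
    using abs_class N'K strN iso that unfolding mu_abstract_class_def by blast+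
  from NK[OF le_refl[OF N'K]] show ?A
    by (simp add: N_def)
  fix \<gamma> \<sigma>
  assume \<gamma>: "\<gamma> \<in> underS \<mu> \<beta>" "underS \<mu> \<gamma> \<noteq> {}" and \<sigma>: "\<sigma> \<in> tuples \<mu> \<gamma> (underS \<mu> \<beta>)"
  define S where "S = apps \<gamma> \<sigma>"
  have S: "S \<subseteq> trms \<beta>"
    unfolding S_def by (rule apps_subset[OF \<sigma>])
  have S': "val M' b' ` S \<subseteq> val M' b' ` D"
    unfolding S_def by (rule good_b'(3)[OF \<gamma> \<sigma>])
  define A where "A = sub_hull M' \<gamma> (tcomp \<gamma> b' \<sigma>)"
  have univ_A: "univ A = val M' b' ` S"
    by (simp add: A_def S_def hull_tcomp)
  have "le A (reduct L M')"
    using M' \<gamma> subsetD[OF underS_Field \<gamma>(1)] tcomp_tuples[OF \<sigma> b'] by (simp add: good_def A_def)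
  \<comment> \<open>Both hulls are strong in the reduct of \<open>M'\<close>, and one contains the
    other; coherence applies.\<close>
  then have "le A N'"
    using le_restr_restr[OF _ good_b'(2)] S' by (simp add: A_def N'_def hull' hull_tcomp S_def)
  then have imA: "le (image_struc \<mu> L g A) N"
    by (rule image)
  \<comment> \<open>Terms in \<open>S\<close> need not lie in \<open>D\<close>, yet \<open>g\<close>
    evaluates them correctly because their values at \<open>b'\<close> are in the hull.\<close>
  have "univ (image_struc \<mu> L g A) = val M b ` S"
    using S S' g by (force simp: image_struc_def univ_A image_image intro!: image_cong)
  moreover have "val M b ` S \<subseteq> hull M \<beta> b"
    using S S' transfer unfolding hull by blast
  ultimately have "image_struc \<mu> L g A = restr \<mu> L (reduct L M) (val M b ` S)"
    using le_eq_restr[OF imA] by (simp add: N_def restr_restr)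
  with imA show "le (sub_hull M \<gamma> (tcomp \<gamma> b \<sigma>)) (sub_hull M \<beta> b)"
    by (simp add: N_def hull_tcomp S_def)
qed


section \<open>The directed union of the hulls\<close>

text \<open>One tuple lists \<open>B\<close> and all entries of the tuples in \<open>J\<close>:
  regularity keeps their number below \<mu>, and repetitions make it longer than every tuple in
  \<open>J\<close>. Each tuple in \<open>J\<close> then is a strictly shorter subtuple.\<close>

lemma hulls_bounded:
  assumes M: "M \<in> EC \<mu> L\<^sub>1 \<U> T\<^sub>1 \<Gamma>" and "univ M \<noteq> {}"
    and J: "J \<subseteq> {(\<gamma>, c). \<gamma> \<in> Field \<mu> \<and> underS \<mu> \<gamma> \<noteq> {} \<and> c \<in> tuples \<mu> \<gamma> (univ M)}" "|J| <o \<mu>"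
    and B: "B \<subseteq> univ M" "|B| <o \<mu>"
  shows "\<exists>\<beta> b. \<beta> \<in> Field \<mu> \<and> underS \<mu> \<beta> \<noteq> {} \<and> b \<in> tuples \<mu> \<beta> (univ M) \<and> B \<subseteq> hull M \<beta> b \<and>
    (\<forall>(\<gamma>, c)\<in>J. le (sub_hull M \<gamma> c) (sub_hull M \<beta> b))"
proof -
  obtain m where m: "m \<in> univ M"
    using assms(2) by blast
  \<comment> \<open>The point \<open>m\<close> keeps \<open>C\<close> nonempty when \<open>B\<close>
    and \<open>J\<close> are empty.\<close>
  define C where "C = B \<union> {m} \<union> (\<Union>(\<gamma>, c)\<in>J. c ` underS \<mu> \<gamma>)"
  have "|case j of (\<gamma>, c) \<Rightarrow> c ` underS \<mu> \<gamma>| <o \<mu>" if j_J: "j \<in> J" for j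
  proof -
    obtain \<gamma> c where j: "j = (\<gamma>, c)" "\<gamma> \<in> Field \<mu>"
      using subsetD[OF J(1) j_J] by (cases j) auto
    then show ?thesis
      using ordLeq_ordLess_trans[OF card_of_image card_of_underS[OF mu_Card_order]] by simp
  qed
  then have "|\<Union>(\<gamma>, c)\<in>J. c ` underS \<mu> \<gamma>| <o \<mu>"
    by (rule stable_UNION[OF regularCard_stable[OF mu_Card_order infinite_mu mu(2)] J(2)])
  then have "|C| <o \<mu>"
    unfolding C_def using B(2) card_singleton_less[OF mu(1)]
    by (intro Un_Cinfinite_bound_strict[OF _ _ mu(1)])
  moreover have "C \<subseteq> univ M"
    using B(1) m J(1) by (fastforce simp: C_def tuples_def)
  moreover have "C \<noteq> {}"
    by (simp add: C_def)
  moreover have "fst ` J \<subseteq> Field \<mu>"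
    using J(1) by auto
  moreover have "|fst ` J| <o \<mu>"
    by (rule ordLeq_ordLess_trans[OF card_of_image J(2)])
  ultimately obtain \<beta> b where \<beta>: "\<beta> \<in> Field \<mu>" "fst ` J \<subseteq> underS \<mu> \<beta>"
    and b: "b \<in> tuples \<mu> \<beta> (univ M)" "b ` underS \<mu> \<beta> = C"
    by - (rule long_tuple[OF mu, of C "univ M" "fst ` J"])
  have ne: "underS \<mu> \<beta> \<noteq> {}"
    using b(2) \<open>C \<noteq> {}\<close> by blast
  have "le (sub_hull M \<gamma> c) (sub_hull M \<beta> b)" if j: "(\<gamma>, c) \<in> J" for \<gamma> c
  proof -
    have \<gamma>: "\<gamma> \<in> underS \<mu> \<beta>" "underS \<mu> \<gamma> \<noteq> {}" "c \<in> tuples \<mu> \<gamma> (univ M)"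
      using j \<beta>(2) J(1) by force+
    have "c ` underS \<mu> \<gamma> \<subseteq> b ` underS \<mu> \<beta>"
      using j by (force simp: b(2) C_def)
    then have "c \<in> tuples \<mu> \<gamma> (b ` underS \<mu> \<beta>)"
      using \<gamma>(3) by (auto simp: tuples_def PiE_iff)
    then obtain \<sigma> where "\<sigma> \<in> tuples \<mu> \<gamma> (underS \<mu> \<beta>)" "c = tcomp \<gamma> b \<sigma>"
      by (rule tuple_of_image)
    then show ?thesis
      using hull_transfer(3)[OF M \<beta>(1) ne b(1) \<gamma>(1,2)] by simp
  qed
  moreover have "B \<subseteq> hull M \<beta> b"
    using hull_transfer(2)[OF M \<beta>(1) ne b(1)] by (auto simp: b(2) C_def)
  ultimately show ?thesis
    using \<beta>(1) ne b(1) by blast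
qed

lemma is_struc_reduct:
  assumes "is_struc \<mu> L\<^sub>1 \<U> M"
  shows "is_struc \<mu> L \<U> (reduct L M)"
proof -
  have "fun_of M (Inl f) \<in> tuples \<mu> (farity L f) (univ M) \<rightarrow>\<^sub>E univ M" if "f \<in> funs L" for f
    using is_struc_fun[OF assms, of "Inl f"] that by simp
  moreover have "rel_of M (Inl r) \<subseteq> tuples \<mu> (rarity L r) (univ M)" if "r \<in> rels L" for r
  proof -
    have "Inl r \<in> rels L\<^sub>1"
      using that by simp
    then have "rel_of M (Inl r) \<subseteq> tuples \<mu> (rarity L\<^sub>1 (Inl r)) (univ M)"
      using assms unfolding is_struc_def by blast
    then show ?thesis by simp
  qed
  moreover have "univ M \<in> \<U>"
    using assms by (simp add: is_struc_def)
  ultimately show ?thesis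
    by (simp add: is_struc_def reduct_def PiE_iff)
qed

text \<open>The hulls form a \<mu>-directed system under \<open>le\<close>, so their union is in
  \<open>K\<close> by the Tarski-Vaught axiom. It is the reduct, since every argument tuple already
  lies in a single hull.\<close>

lemma reduct_in_K_nonempty:
  assumes M: "M \<in> EC \<mu> L\<^sub>1 \<U> T\<^sub>1 \<Gamma>" and ne: "univ M \<noteq> {}"
  shows "reduct L M \<in> K"
proof -
  have strM: "is_struc \<mu> L\<^sub>1 \<U> M"
    using M by (simp add: EC_def)
  define X where "X = {(\<gamma>, c). \<gamma> \<in> Field \<mu> \<and> underS \<mu> \<gamma> \<noteq> {} \<and> c \<in> tuples \<mu> \<gamma> (univ M)}"
  \<comment> \<open>The indices are structures rather than tuples: distinct tuples may have the same
    hull, which would destroy antisymmetry.\<close>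
  define I where "I = (\<lambda>(\<gamma>, c). sub_hull M \<gamma> c) ` X"
  define R where "R = {(N, N'). N \<in> I \<and> N' \<in> I \<and> le N N'}"
  have I_K: "N \<in> K" and I_sub: "substruc \<mu> L N (reduct L M)" if "N \<in> I" for N
    using that hull_transfer(1)[OF M] hull_subset[OF strM] substruc_restr[of _ "reduct L M" \<mu> L]
    by (auto simp: I_def X_def)
  \<comment> \<open>With \<open>B\<close> empty this is directedness; with \<open>A\<close> empty it
    says that small subsets of the universe are contained in a single hull.\<close>
  have bound: "\<exists>N\<in>I. B \<subseteq> univ N \<and> (\<forall>N'\<in>A. le N' N)"
    if A: "A \<subseteq> I" "|A| <o \<mu>" and B: "B \<subseteq> univ M" "|B| <o \<mu>" for A B
  proof -
    \<comment> \<open>One tuple is chosen for each structure in \<open>A\<close>, because the full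
      preimage of \<open>A\<close> may be too large.\<close>
    define J where "J = inv_into X (\<lambda>(\<gamma>, c). sub_hull M \<gamma> c) ` A"
    have J: "J \<subseteq> X"
      unfolding J_def
      by (rule image_subsetI) (rule inv_into_into[OF subsetD[OF A(1)[unfolded I_def]]])
    have A_J: "A = (\<lambda>(\<gamma>, c). sub_hull M \<gamma> c) ` J"
      unfolding J_def by (rule image_inv_into_cancel[OF refl A(1)[unfolded I_def], symmetric])
    have "|J| <o \<mu>"
      unfolding J_def by (rule ordLeq_ordLess_trans[OF card_of_image A(2)])
    from hulls_bounded[OF M ne J[unfolded X_def] this B]
    obtain \<beta> b where \<beta>: "\<beta> \<in> Field \<mu>" "underS \<mu> \<beta> \<noteq> {}" "b \<in> tuples \<mu> \<beta> (univ M)" "B \<subseteq> hull M \<beta> b"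
      "\<forall>(\<gamma>, c)\<in>J. le (sub_hull M \<gamma> c) (sub_hull M \<beta> b)"
      by (elim exE conjE)
    have "sub_hull M \<beta> b \<in> I"
      unfolding I_def by (rule image_eqI[of _ _ "(\<beta>, b)"]) (use \<beta> in \<open>auto simp: X_def\<close>)
    moreover have "\<forall>N'\<in>A. le N' (sub_hull M \<beta> b)"
      unfolding A_J using \<beta>(5) by auto
    ultimately show ?thesis
      using \<beta>(4) by (intro bexI[of _ "sub_hull M \<beta> b"]) simp_all
  qed
  have empty_less: "|{}| <o \<mu>"
    by (rule ordLeq_ordLess_trans[OF card_of_empty card_singleton_less[OF mu(1)]])
  have "partial_order_on I R"
  proof -
    have "N = N'" if "le N N'" "le N' N" for N N'
    proof -
      have "univ N = univ N'"
        using le_substruc[OF that(1)] le_substruc[OF that(2)] by (auto simp: substruc_def)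
      then show ?thesis
        using le_eq_restr[OF that(1)] restr_univ[OF K_struc[OF le_K(2)[OF that(1)]]] by simp
    qed
    moreover have "trans R"
      using le_trans unfolding R_def trans_def by blast
    moreover have "refl_on I R"
      using le_refl I_K unfolding R_def refl_on_def by blast
    ultimately show ?thesis
      unfolding partial_order_on_def preorder_on_def antisym_def by (auto simp: R_def)
  qed
  moreover have "\<exists>N\<in>I. \<forall>N'\<in>A. (N', N) \<in> R" if "A \<subseteq> I" "|A| <o \<mu>" for A
    using bound[OF that, of "{}"] empty_less that(1) unfolding R_def by blast
  ultimately have dir: "mu_directed \<mu> I R"
    unfolding mu_directed_def by blast
  have UN: "(\<Union>N\<in>I. univ N) = univ M"
  proof
    show "(\<Union>N\<in>I. univ N) \<subseteq> univ M"
    proof (rule UN_least)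
      fix N assume "N \<in> I"
      then show "univ N \<subseteq> univ M"
        using I_sub[of N] by (simp add: substruc_def)
    qed
    show "univ M \<subseteq> (\<Union>N\<in>I. univ N)"
    proof
      fix m assume "m \<in> univ M"
      then show "m \<in> (\<Union>N\<in>I. univ N)"
        using bound[of "{}" "{m}"] empty_less card_singleton_less[OF mu(1), of m] by auto
    qed
  qed
  define V where "V = union_struc \<mu> L I (\<lambda>N. N)"
  have univ_V: "univ V = univ M"
    by (simp add: V_def union_struc_def UN)
  have "univ M \<in> \<U>"
    using strM by (simp add: is_struc_def)
  then have V: "V \<in> K" "\<And>N. N \<in> I \<Longrightarrow> le N V"
    using tv[unfolded tarski_vaught_def, THEN spec[of _ I], THEN spec[of _ R], THEN spec[of _ "\<lambda>N. N"]]
      dir I_K by (simp_all add: V_def R_def UN)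
  have cover: "\<exists>N\<in>I. t \<in> tuples \<mu> \<alpha> (univ N)" if \<alpha>: "\<alpha> \<in> Field \<mu>" and t: "t \<in> tuples \<mu> \<alpha> (univ M)" for \<alpha> t
  proof -
    have "t ` underS \<mu> \<alpha> \<subseteq> univ M"
      using t by (auto simp: tuples_def)
    moreover have "|t ` underS \<mu> \<alpha>| <o \<mu>"
      by (rule ordLeq_ordLess_trans[OF card_of_image card_of_underS[OF mu_Card_order \<alpha>]])
    ultimately obtain N where "N \<in> I" "t ` underS \<mu> \<alpha> \<subseteq> univ N"
      using bound[of "{}" "t ` underS \<mu> \<alpha>"] empty_less by auto
    moreover have "t \<in> tuples \<mu> \<alpha> (univ N)"
      using t \<open>t ` underS \<mu> \<alpha> \<subseteq> univ N\<close> by (auto simp: tuples_def PiE_iff)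
    ultimately show ?thesis by blast
  qed
  have "substruc \<mu> L V (reduct L M)"
    unfolding substruc_def
  proof (intro conjI ballI)
    show "univ V \<subseteq> univ (reduct L M)"
      by (simp add: univ_V)
    fix f t assume f: "f \<in> funs L" and t: "t \<in> tuples \<mu> (farity L f) (univ V)"
    then obtain N where N: "N \<in> I" "t \<in> tuples \<mu> (farity L f) (univ N)"
      using cover[of "farity L f" t] lang_L by (auto simp: univ_V mu_ary_lang_def)
    have "fun_of N f t = fun_of V f t"
      using le_substruc[OF V(2)[OF N(1)]] f N(2) by (simp add: substruc_def)
    moreover have "fun_of N f t = fun_of (reduct L M) f t"
      using I_sub[OF N(1)] f N(2) by (simp add: substruc_def)
    ultimately show "fun_of V f t = fun_of (reduct L M) f t" by simp
  next
    fix r assume r: "r \<in> rels L"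
    have "t \<in> rel_of V r \<longleftrightarrow> t \<in> rel_of (reduct L M) r"
      if t: "t \<in> tuples \<mu> (rarity L r) (univ V)" for t
    proof -
      obtain N where N: "N \<in> I" "t \<in> tuples \<mu> (rarity L r) (univ N)"
        using cover[of "rarity L r" t] lang_L r t by (auto simp: univ_V mu_ary_lang_def)
      have "t \<in> rel_of N r \<longleftrightarrow> t \<in> rel_of V r"
        using le_substruc[OF V(2)[OF N(1)]] r N(2) by (simp add: substruc_def)
      moreover have "t \<in> rel_of N r \<longleftrightarrow> t \<in> rel_of (reduct L M) r"
        using I_sub[OF N(1)] r N(2) by (simp add: substruc_def)
      ultimately show ?thesis by simp
    qed
    moreover have "rel_of V r \<subseteq> tuples \<mu> (rarity L r) (univ V)"
      using K_struc[OF V(1)] r by (simp add: is_struc_def)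
    ultimately show "rel_of V r = rel_of (reduct L M) r \<inter> tuples \<mu> (rarity L r) (univ V)"
      by blast
  qed
  \<comment> \<open>A substructure on the full universe is the whole structure.\<close>
  from substruc_eq_restr[OF K_struc[OF V(1)] this]
  have "V = reduct L M"
    using restr_univ[OF is_struc_reduct[OF strM]] by (simp add: univ_V)
  then show ?thesis
    using V(1) by simp
qed

text \<open>Hulls are available for nonempty tuples only, so the empty tuple is used instead. A good
  structure realizing its type is empty too and has the same relations of arity 0, which determine
  an empty structure.\<close>

lemma reduct_in_K_empty:
  assumes M: "M \<in> EC \<mu> L\<^sub>1 \<U> T\<^sub>1 \<Gamma>" and empty: "univ M = {}"
  shows "reduct L M \<in> K"
proof -
  have strM: "is_struc \<mu> L\<^sub>1 \<U> M"
    using M by (simp add: EC_def)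
  have "wf (\<mu> - Id)"
    using mu_Card_order by (simp add: card_order_on_def well_order_on_def)
  moreover obtain x where "x \<in> Field \<mu>"
    using infinite_mu by fastforce
  \<comment> \<open>The minimal element is the ordinal 0; the only tuple of this length is
    \<open>\<lambda>_. undefined\<close>.\<close>
  ultimately obtain \<beta> where \<beta>: "\<beta> \<in> Field \<mu>" "\<forall>y. (y, \<beta>) \<in> \<mu> - Id \<longrightarrow> y \<notin> Field \<mu>"
    unfolding wf_eq_minimal by blast
  then have under: "underS \<mu> \<beta> = {}"
    by (auto simp: underS_def Field_def)
  then have "(\<lambda>_. undefined) \<in> tuples \<mu> \<beta> (univ M)"
    by (simp add: tuples_def)
  then obtain M' b' where M': "good M'" and st: "same_type \<beta> M (\<lambda>_. undefined) M' b'"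
    by (rule realized_in_good[OF M \<beta>(1)])
  have "nonempty_fm \<in> fms \<beta>"
    by (simp add: fms_def)
  then have empty': "univ M' = {}"
    using st empty by (auto simp: same_type_def nonempty_fm)
  have strM': "is_struc \<mu> L\<^sub>1 \<U> M'"
    using M' by (simp add: good_def)
  have "reduct L M = reduct L M'"
  proof (rule struc.equality)
    have "fun_of M (Inl f) = fun_of M' (Inl f)" if f: "f \<in> funs L" for f
    proof
      fix t
      \<comment> \<open>A function into the empty set has an empty domain, and off the domain both
        functions are \<open>undefined\<close>.\<close>
      have "fun_of M (Inl f) \<in> tuples \<mu> (farity L f) {} \<rightarrow>\<^sub>E {}" "fun_of M' (Inl f) \<in> tuples \<mu> (farity L f) {} \<rightarrow>\<^sub>E {}"
        using is_struc_fun[OF strM, of "Inl f"] is_struc_fun[OF strM', of "Inl f"] f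
        by (simp_all add: empty empty')
      then show "fun_of M (Inl f) t = fun_of M' (Inl f) t"
        by (cases "t \<in> tuples \<mu> (farity L f) {}") (auto simp: PiE_iff extensional_def)
    qed
    then show "fun_of (reduct L M) = fun_of (reduct L M')"
      by (auto simp: reduct_def fun_eq_iff)
    have "t \<in> rel_of M (Inl r) \<longleftrightarrow> t \<in> rel_of M' (Inl r)"
      if r: "r \<in> rels L" and t: "t \<in> tuples \<mu> (rarity L r) {}" for r t
    proof -
      \<comment> \<open>Over an empty universe a tuple exists only in length 0.\<close>
      have u: "underS \<mu> (rarity L r) = {}" and t_eq: "t = (\<lambda>_. undefined)"
        using t by (auto simp: tuples_def PiE_iff extensional_def)
      have "(\<lambda>_. undefined) \<in> tuples \<mu> (rarity L r) (trms \<beta>)"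
        by (simp add: tuples_def u)
      from same_type_rel[OF st r this] show ?thesis
        by (simp add: compose_def u t_eq restrict_def)
    qed
    moreover have "rel_of M (Inl r) \<subseteq> tuples \<mu> (rarity L r) {}" "rel_of M' (Inl r) \<subseteq> tuples \<mu> (rarity L r) {}"
      if "r \<in> rels L" for r
      using is_struc_reduct[OF strM] is_struc_reduct[OF strM'] that
      by (simp_all add: is_struc_def reduct_def empty empty')
    ultimately have "rel_of M (Inl r) = rel_of M' (Inl r)" if "r \<in> rels L" for r
      using that by blast
    then show "rel_of (reduct L M) = rel_of (reduct L M')"
      by (auto simp: reduct_def fun_eq_iff)
  qed (simp_all add: empty empty')
  then show ?thesis
    using M' by (simp add: good_def)
qed

lemma K_eq_PC: "K = PC \<mu> L\<^sub>1 \<U> T\<^sub>1 \<Gamma> L"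
proof
  show "PC \<mu> L\<^sub>1 \<U> T\<^sub>1 \<Gamma> L \<subseteq> K"
    using reduct_in_K_empty reduct_in_K_nonempty unfolding PC_def by blast
qed (rule K_subset_PC)

end

section \<open>The arity map and the conclusion\<close>

text \<open>The set \<open>P\<close> of nonzero ordinals below \<mu> has size at most \<chi>, so
  there is a bijection from \<open>Field \<chi>\<close> onto \<open>Field \<chi> \<times> P\<close>.
  Its second coordinate has all fibres of size \<chi>.\<close>

lemma ex_arity:
  fixes \<mu> :: "'m rel" and \<chi> :: "'c rel"
  assumes \<mu>: "Cinfinite \<mu>" and \<chi>: "Cinfinite \<chi>" and le: "\<mu> \<le>o \<chi>"
  shows "\<exists>ar :: 'c \<Rightarrow> 'm. (\<forall>c\<in>Field \<chi>. ar c \<in> Field \<mu> \<and> underS \<mu> (ar c) \<noteq> {}) \<and>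
    (\<forall>\<beta>\<in>Field \<mu>. underS \<mu> \<beta> \<noteq> {} \<longrightarrow> \<chi> \<le>o |{c \<in> Field \<chi>. ar c = \<beta>}| )"
proof -
  define P where "P = {\<beta> \<in> Field \<mu>. underS \<mu> \<beta> \<noteq> {}}"
  have inf: "\<not> finite (Field \<mu>)" "\<not> finite (Field \<chi>)"
    using \<mu> \<chi> by (simp_all add: cinfinite_def)
  then obtain a where "a \<in> Field \<mu>"
    by fastforce
  then obtain b where "b \<in> Field \<mu>" "a \<noteq> b" "(a, b) \<in> \<mu>"
    using infinite_Card_order_limit[OF conjunct2[OF \<mu>] inf(1)] by blast
  then have "P \<noteq> {}"
    by (auto simp: P_def underS_def)
  moreover have "|P| \<le>o |Field \<chi>|"
    by (rule ordLeq_transitive[OF card_of_mono1 card_of_mono2[OF le]]) (auto simp: P_def)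
  ultimately have "|Field \<chi>| =o |Field \<chi> \<times> P|"
    by (rule ordIso_symmetric[OF conjunct1[OF card_of_Times_infinite[OF inf(2)]]])
  then have "\<exists>k. bij_betw k (Field \<chi>) (Field \<chi> \<times> P)"
    by (rule iffD2[OF card_of_ordIso])
  then obtain k where k: "bij_betw k (Field \<chi>) (Field \<chi> \<times> P)" ..
  have "\<chi> \<le>o |{c \<in> Field \<chi>. snd (k c) = \<beta>}|" if "\<beta> \<in> P" for \<beta>
  proof -
    have "k ` {c \<in> Field \<chi>. snd (k c) = \<beta>} = {p \<in> k ` Field \<chi>. snd p = \<beta>}"
      by blast
    also have "\<dots> = Field \<chi> \<times> {\<beta>}"
      unfolding bij_betw_imp_surj_on[OF k] using that by auto
    finally have "fst ` k ` {c \<in> Field \<chi>. snd (k c) = \<beta>} = Field \<chi>"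
      by simp
    then have "(\<lambda>c. fst (k c)) ` {c \<in> Field \<chi>. snd (k c) = \<beta>} = Field \<chi>"
      by (simp only: image_image)
    then have "|Field \<chi>| \<le>o |{c \<in> Field \<chi>. snd (k c) = \<beta>}|"
      using card_of_image[of "\<lambda>c. fst (k c)" "{c \<in> Field \<chi>. snd (k c) = \<beta>}"] by simp
    then show ?thesis
      by (rule ordIso_ordLeq_trans[OF ordIso_symmetric[OF card_of_Field_ordIso[OF conjunct2[OF \<chi>]]]])
  qed
  moreover have "snd (k c) \<in> P" if "c \<in> Field \<chi>" for c
    using bij_betwE[OF k] that by (auto simp: mem_Times_iff)
  ultimately show ?thesis
    by (intro exI[of _ "\<lambda>c. snd (k c)"]) (simp add: P_def)
qed

theorem theorem3p2:
  fixes \<mu> :: "'m rel"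
    and L :: "('f, 'r, 'm) lang"
    and \<U> :: "'a set set"
    and K :: "('f, 'r, 'm, 'a) struc set"
    and le :: "('f, 'r, 'm, 'a) struc \<Rightarrow> ('f, 'r, 'm, 'a) struc \<Rightarrow> bool"
    and \<chi> :: "'c rel"
  assumes "\<And>X Y. X \<in> \<U> \<Longrightarrow> Y \<subseteq> X \<Longrightarrow> Y \<in> \<U>"
    and "mu_AEC TYPE('c) \<mu> L \<U> K le"
    and "is_LS \<mu> L K le \<chi>"
  shows "\<exists>(L\<^sub>1 :: ('f + 'c, 'r + 'c, 'm) lang)
            (T\<^sub>1 :: ('f + 'c, 'r + 'c, 'm) fm set)
            (\<Gamma> :: ('m set \<times> ('f + 'c, 'r + 'c, 'm) fm set) set).
          mu_ary_lang \<mu> L\<^sub>1 \<and> sublang L L\<^sub>1 \<and>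
          is_theory \<mu> L\<^sub>1 T\<^sub>1 \<and> |T\<^sub>1| =o \<chi> \<and>
          (\<forall>p\<in>\<Gamma>. is_type \<mu> L\<^sub>1 p) \<and> |\<Gamma>| \<le>o ctwo ^c \<chi> \<and>
          K = PC \<mu> L\<^sub>1 \<U> T\<^sub>1 \<Gamma> L"
proof -
  have aec: "Cinfinite \<mu>" "regularCard \<mu>" "mu_abstract_class \<mu> L \<U> K le" "coherence \<mu> L K le"
    "tarski_vaught \<mu> L \<U> K le"
    using assms(2) by (auto simp: mu_AEC_def)
  have lst: "lst_cardinal \<mu> L K le \<chi>"
    using assms(3) by (simp add: is_LS_def)
  then have \<chi>: "Card_order \<chi>" and "|funs L <+> rels L| +c \<mu> \<le>o \<chi>"
    by (simp_all add: lst_cardinal_def)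
  then have le: "\<mu> \<le>o \<chi>"
    by - (rule ordLeq_transitive[OF ordLeq_csum2[OF conjunct2[OF aec(1)]]])
  then have "Cinfinite \<chi>"
    using cinfinite_mono[OF le] aec(1) \<chi> by simp
  from ex_arity[OF aec(1) this le]
  obtain ar :: "'c \<Rightarrow> 'm" where ar: "\<forall>c\<in>Field \<chi>. ar c \<in> Field \<mu> \<and> underS \<mu> (ar c) \<noteq> {}"
    "\<forall>\<beta>\<in>Field \<mu>. underS \<mu> \<beta> \<noteq> {} \<longrightarrow> \<chi> \<le>o |{c \<in> Field \<chi>. ar c = \<beta>}|"
    by blast
  interpret presentation \<mu> L \<U> K le \<chi> ar
  proof
    show "Y \<in> \<U>" if "X \<in> \<U>" "Y \<subseteq> X" for X Y
      using assms(1)[OF that] .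
  qed (use aec lst ar in simp_all)
  show ?thesis
    by (intro exI[of _ L\<^sub>1] exI[of _ T\<^sub>1] exI[of _ \<Gamma>] conjI ballI mu_ary_lang_L\<^sub>1 sublang_L\<^sub>1
      T\<^sub>1_is_theory card_T\<^sub>1 \<Gamma>_is_type card_\<Gamma> K_eq_PC)
qed

end
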